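(* Let $Z\in\mathbb R^{N_1}$ and $0<\tau\le\dfrac{1}{2\|\hat k\|_\infty}$. Then the fixed point problem $$Y=G(Y),\qquad G(Y)=B^{-1}\big[MZ-\tau\,S(K^{-1}MY)\,Y\big],$$ admits a solution $Y\in\mathbb R^{N_1}$.
   Context: Let $L>0$, $\Omega=(0,L)\times(0,L)$, and let $\hat k\in\mathbb R$ be a constant, $\|\hat k\|_\infty=|\hat k|$ (if $\hat k=0$, the bound $\tau\le 1/(2\|\hat k\|_\infty)$ is no restriction). $\langle\cdot,\cdot\rangle$ is the $L^2(\Omega)$ inner product and $\langle u,v\rangle_1=\langle u,v\rangle+\langle\nabla u,\nabla v\rangle$. $H^1_P(\Omega)$ is the space of $u\in H^1(\Omega)$ with $u(x,0)=u(x,L)$ for a.e. $x$ and $u(0,y)=u(L,y)$ for a.e. $y$. $\vec V(v)=(-v_y,v_x)$. For $n\ge2$, let $0=x_1<\dots<x_n=L$ and $0=y_1<\dots<y_n=L$ be partitions and $\mathcal T$ the triangulation of $\overline\Omega$ obtained by cutting each rectangle $[x_i,x_{i+1}]\times[y_j,y_{j+1}]$ along the diagonal from its lower-left to its upper-right vertex. $X_N$ ($N=n^2$) is the space of continuous functions on $\overline\Omega$ that are affine on each triangle, and $X_{N,P}=X_N\cap H^1_P(\Omega)$, of dimension $N_1=(n-1)^2$, with periodic nodal basis $\varphi_1,\dots,\varphi_{N_1}$. A vector $V\in\mathbb R^{N_1}$ is identified with $v_N=\sum_I V_I\varphi_I$. Matrices (row $J$, column $I$): $M_{JI}=\langle\varphi_I,\varphi_J\rangle$,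 $K_{JI}=\langle\varphi_I,\varphi_J\rangle_1$, $R_{JI}=\langle\hat k\,\partial_y\varphi_I,\varphi_J\rangle$, and for $U\in\mathbb R^{N_1}$ with $u_N=\sum_I U_I\varphi_I$, $S(U)_{JI}=\langle\vec V(u_N)\cdot\nabla\varphi_I,\varphi_J\rangle$. Put $B=M-\tau RK^{-1}M$, which is invertible for $0<\tau\le 1/(2\|\hat k\|_\infty)$. With $Z=W(t)$, a fixed point $Y=W(t+\tau)$ of $G$ together with $U(t+\tau)=K^{-1}MY$ is a solution of the fully implicit scheme $(M+\tau S(U(t+\tau)))W(t+\tau)-\tau RU(t+\tau)=MW(t)$, $KU(t+\tau)=MW(t+\tau)$. *)

theory Defs
  imports "HOL-Analysis.Analysis"
begin

primrec C_k :: "nat \<Rightarrow> ('a::euclidean_space \<Rightarrow> real) \<Rightarrow> bool" where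
  "C_k 0 f \<longleftrightarrow> continuous_on UNIV f"
| "C_k (Suc k) f \<longleftrightarrow> (\<forall>p. f differentiable (at p)) \<and>
     (\<forall>e\<in>Basis. C_k k (\<lambda>p. frechet_derivative f (at p) e))"

definition test_functions :: "'a::euclidean_space set \<Rightarrow> ('a \<Rightarrow> real) set" where
  "test_functions \<Omega> = {\<psi>. (\<forall>k. C_k k \<psi>) \<and>
     compact (closure {p. \<psi> p \<noteq> 0}) \<and> closure {p. \<psi> p \<noteq> 0} \<subseteq> \<Omega>}"

definition locally_integrable :: "'a::euclidean_space set \<Rightarrow> ('a \<Rightarrow> real) \<Rightarrow> bool" where
  "locally_integrable \<Omega> u \<longleftrightarrow> (\<forall>C. compact C \<and> C \<subseteq> \<Omega> \<longrightarrow> u absolutely_integrable_on C)"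

definition is_weak_deriv ::
  "'a::euclidean_space set \<Rightarrow> 'a \<Rightarrow> ('a \<Rightarrow> real) \<Rightarrow> ('a \<Rightarrow> real) \<Rightarrow> bool" where
  "is_weak_deriv \<Omega> e u g \<longleftrightarrow> locally_integrable \<Omega> u \<and> locally_integrable \<Omega> g \<and>
     (\<forall>\<psi>\<in>test_functions \<Omega>.
        (LINT p|lebesgue_on \<Omega>. u p * frechet_derivative \<psi> (at p) e) =
        - (LINT p|lebesgue_on \<Omega>. g p * \<psi> p))"

text \<open>The weak derivative is unique only up to null sets; the choice of a representative does
  not affect any of the integrals below.\<close>

definition weak_deriv ::
  "'a::euclidean_space set \<Rightarrow> 'a \<Rightarrow> ('a \<Rightarrow> real) \<Rightarrow> 'a \<Rightarrow> real" where
  "weak_deriv \<Omega> e u = (SOME g. is_weak_deriv \<Omega> e u g)"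

definition L2_space :: "'a::euclidean_space set \<Rightarrow> ('a \<Rightarrow> real) set" where
  "L2_space \<Omega> = {u. u \<in> borel_measurable (lebesgue_on \<Omega>) \<and>
     integrable (lebesgue_on \<Omega>) (\<lambda>p. (u p)\<^sup>2)}"

definition H1_space :: "'a::euclidean_space set \<Rightarrow> ('a \<Rightarrow> real) set" where
  "H1_space \<Omega> = {u \<in> L2_space \<Omega>. \<forall>e\<in>Basis. \<exists>g\<in>L2_space \<Omega>. is_weak_deriv \<Omega> e u g}"

definition d_x :: "(real \<times> real) set \<Rightarrow> (real \<times> real \<Rightarrow> real) \<Rightarrow> real \<times> real \<Rightarrow> real" where
  "d_x \<Omega> u = weak_deriv \<Omega> (1, 0) u"

definition d_y :: "(real \<times> real) set \<Rightarrow> (real \<times> real \<Rightarrow> real) \<Rightarrow> real \<times> real \<Rightarrow> real" where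
  "d_y \<Omega> u = weak_deriv \<Omega> (0, 1) u"

definition grad ::
  "(real \<times> real) set \<Rightarrow> (real \<times> real \<Rightarrow> real) \<Rightarrow> real \<times> real \<Rightarrow> real \<times> real" where
  "grad \<Omega> u p = (d_x \<Omega> u p, d_y \<Omega> u p)"

definition flow_field ::
  "(real \<times> real) set \<Rightarrow> (real \<times> real \<Rightarrow> real) \<Rightarrow> real \<times> real \<Rightarrow> real \<times> real" where
  "flow_field \<Omega> v p = (- d_y \<Omega> v p, d_x \<Omega> v p)"

definition L2_inner ::
  "'a::euclidean_space set \<Rightarrow> ('a \<Rightarrow> 'b::euclidean_space) \<Rightarrow> ('a \<Rightarrow> 'b) \<Rightarrow> real" where
  "L2_inner \<Omega> u v = (LINT p|lebesgue_on \<Omega>. u p \<bullet> v p)"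

definition H1_inner ::
  "(real \<times> real) set \<Rightarrow> (real \<times> real \<Rightarrow> real) \<Rightarrow> (real \<times> real \<Rightarrow> real) \<Rightarrow> real" where
  "H1_inner \<Omega> u v = L2_inner \<Omega> u v + L2_inner \<Omega> (grad \<Omega> u) (grad \<Omega> v)"

definition square :: "real \<Rightarrow> (real \<times> real) set" where
  "square L = {0<..<L} \<times> {0<..<L}"

text \<open>Functions are total on the plane, and the boundary conditions refer to the boundary values
  of the given function rather than to a trace. Below, this space is only intersected with
  functions that are continuous on the closed square, for which the two coincide.\<close>

definition H1_periodic :: "real \<Rightarrow> (real \<times> real \<Rightarrow> real) set" where
  "H1_periodic L = {u \<in> H1_space (square L).
     (AE s in lebesgue_on {0..L}. u (s, 0) = u (s, L)) \<and>
     (AE t in lebesgue_on {0..L}. u (0, t) = u (L, t))}"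

definition is_partition :: "real \<Rightarrow> nat \<Rightarrow> (nat \<Rightarrow> real) \<Rightarrow> bool" where
  "is_partition L n x \<longleftrightarrow> x 1 = 0 \<and> x n = L \<and> strict_mono_on {1..n} x"

definition triangulation ::
  "nat \<Rightarrow> (nat \<Rightarrow> real) \<Rightarrow> (nat \<Rightarrow> real) \<Rightarrow> (real \<times> real) set set" where
  "triangulation n x y = (\<Union>i\<in>{1..<n}. \<Union>j\<in>{1..<n}.
     {convex hull {(x i, y j), (x (i + 1), y j), (x (i + 1), y (j + 1))},
      convex hull {(x i, y j), (x i, y (j + 1)), (x (i + 1), y (j + 1))}})"

definition fe_space ::
  "real \<Rightarrow> nat \<Rightarrow> (nat \<Rightarrow> real) \<Rightarrow> (nat \<Rightarrow> real) \<Rightarrow> (real \<times> real \<Rightarrow> real) set" where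
  "fe_space L n x y = {u. continuous_on ({0..L} \<times> {0..L}) u \<and>
     (\<forall>T\<in>triangulation n x y. \<exists>a b c. \<forall>(s, t)\<in>T. u (s, t) = a * s + b * t + c)}"

definition fe_space_periodic ::
  "real \<Rightarrow> nat \<Rightarrow> (nat \<Rightarrow> real) \<Rightarrow> (nat \<Rightarrow> real) \<Rightarrow> (real \<times> real \<Rightarrow> real) set" where
  "fe_space_periodic L n x y = fe_space L n x y \<inter> H1_periodic L"

text \<open>The type of indices stands for \<open>{1..(n-1)\<^sup>2}\<close>; the bijection \<open>node\<close> numbers the
  grid points \<open>(x i, y j)\<close> with \<open>1 \<le> i, j \<le> n - 1\<close>, which represent all grid points modulo
  periodicity. The nodal values determine the basis functions on the closed square.\<close>

definition periodic_nodal_basis ::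
  "real \<Rightarrow> nat \<Rightarrow> (nat \<Rightarrow> real) \<Rightarrow> (nat \<Rightarrow> real) \<Rightarrow> ('m::finite \<Rightarrow> nat \<times> nat) \<Rightarrow>
   ('m \<Rightarrow> real \<times> real \<Rightarrow> real) \<Rightarrow> bool" where
  "periodic_nodal_basis L n x y node \<phi> \<longleftrightarrow>
     bij_betw node UNIV ({1..<n} \<times> {1..<n}) \<and>
     (\<forall>I. \<phi> I \<in> fe_space_periodic L n x y) \<and>
     (\<forall>I J. \<phi> I (x (fst (node J)), y (snd (node J))) = (if I = J then 1 else 0))"

definition fe_function ::
  "('m::finite \<Rightarrow> real \<times> real \<Rightarrow> real) \<Rightarrow> real ^ 'm \<Rightarrow> real \<times> real \<Rightarrow> real" where
  "fe_function \<phi> V p = (\<Sum>I\<in>UNIV. V $ I * \<phi> I p)"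

definition M_mat ::
  "(real \<times> real) set \<Rightarrow> ('m::finite \<Rightarrow> real \<times> real \<Rightarrow> real) \<Rightarrow> real ^ 'm ^ 'm" where
  "M_mat \<Omega> \<phi> = (\<chi> J I. L2_inner \<Omega> (\<phi> I) (\<phi> J))"

definition K_mat ::
  "(real \<times> real) set \<Rightarrow> ('m::finite \<Rightarrow> real \<times> real \<Rightarrow> real) \<Rightarrow> real ^ 'm ^ 'm" where
  "K_mat \<Omega> \<phi> = (\<chi> J I. H1_inner \<Omega> (\<phi> I) (\<phi> J))"

definition R_mat ::
  "(real \<times> real) set \<Rightarrow> ('m::finite \<Rightarrow> real \<times> real \<Rightarrow> real) \<Rightarrow> real \<Rightarrow> real ^ 'm ^ 'm" where
  "R_mat \<Omega> \<phi> k = (\<chi> J I. L2_inner \<Omega> (\<lambda>p. k * d_y \<Omega> (\<phi> I) p) (\<phi> J))"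

definition S_mat ::
  "(real \<times> real) set \<Rightarrow> ('m::finite \<Rightarrow> real \<times> real \<Rightarrow> real) \<Rightarrow> real ^ 'm \<Rightarrow> real ^ 'm ^ 'm" where
  "S_mat \<Omega> \<phi> U = (\<chi> J I.
     L2_inner \<Omega> (\<lambda>p. flow_field \<Omega> (fe_function \<phi> U) p \<bullet> grad \<Omega> (\<phi> I) p) (\<phi> J))"

definition B_mat ::
  "(real \<times> real) set \<Rightarrow> ('m::finite \<Rightarrow> real \<times> real \<Rightarrow> real) \<Rightarrow> real \<Rightarrow> real \<Rightarrow> real ^ 'm ^ 'm"
  where
  "B_mat \<Omega> \<phi> k \<tau> =
     M_mat \<Omega> \<phi> - \<tau> *\<^sub>R (R_mat \<Omega> \<phi> k ** matrix_inv (K_mat \<Omega> \<phi>) ** M_mat \<Omega> \<phi>)"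

definition G_map ::
  "(real \<times> real) set \<Rightarrow> ('m::finite \<Rightarrow> real \<times> real \<Rightarrow> real) \<Rightarrow> real \<Rightarrow> real \<Rightarrow>
   real ^ 'm \<Rightarrow> real ^ 'm \<Rightarrow> real ^ 'm" where
  "G_map \<Omega> \<phi> k \<tau> Z Y =
     matrix_inv (B_mat \<Omega> \<phi> k \<tau>) *v
       (M_mat \<Omega> \<phi> *v Z -
        \<tau> *\<^sub>R (S_mat \<Omega> \<phi> (matrix_inv (K_mat \<Omega> \<phi>) *v (M_mat \<Omega> \<phi> *v Y)) *v Y))"

end

theory Submission
  imports Defs "HOL-Computational_Algebra.Polynomial"
begin

text \<open>
  A fixed point of the map is a zero of
  \<open>F Y = B Y + \<tau> S(U) Y - M Z\<close> with \<open>U = K\<^sup>-\<^sup>1 M Y\<close>, and such a zero exists by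
  Brouwer's theorem as soon as \<open>Y \<bullet> F Y > 0\<close> on a large sphere
  (\<open>exists_zero_if_outward_on_sphere\<close>). Write \<open>w\<close> and \<open>u\<close> for the finite element functions with
  coefficients \<open>Y\<close> and \<open>U\<close>. Three facts about the quadratic forms give the sign.

  First, \<open>Y \<bullet> M Y\<close> is the squared \<open>L\<^sup>2\<close> norm of \<open>w\<close>, hence positive definite, and in finite
  dimension it dominates a multiple of the squared norm of \<open>Y\<close>.

  Second, \<open>Y \<bullet> B Y \<ge> (Y \<bullet> M Y) / 2\<close>. Testing \<open>K U = M Y\<close> with \<open>U\<close> gives
  \<open>\<parallel>u\<parallel>\<^sup>2 + \<parallel>\<nabla>u\<parallel>\<^sup>2 = \<langle>w, u\<rangle> \<le> \<parallel>u\<parallel>\<^sup>2 + \<parallel>w\<parallel>\<^sup>2 / 4\<close>, so \<open>\<parallel>u\<^sub>y\<parallel>\<^sup>2 \<le> \<parallel>w\<parallel>\<^sup>2 / 4\<close>, and the term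
  \<open>\<tau> k \<langle>u\<^sub>y, w\<rangle>\<close> is absorbed because \<open>\<tau> \<bar>k\<bar> \<le> 1/2\<close>. The same bound makes \<open>B\<close> invertible.

  Third, \<open>Y \<bullet> S(U) Y = \<integral> (u\<^sub>x w\<^sub>y - u\<^sub>y w\<^sub>x) w = 0\<close> for all \<open>U\<close> and \<open>Y\<close>. On one triangle the
  gradients are constant and the integral of \<open>w\<close> is a third of the area times the sum of the vertex
  values; the result is a sum of terms attached to the oriented edges of the triangle and
  antisymmetric under reversal (\<open>triangle_edge_terms\<close>). Adding up the triangles, an interior edge is
  met once in each direction, and the boundary edges cancel by periodicity
  (\<open>sum_grid_edge_terms_eq_0\<close>).

  The partial derivatives in the matrices are weak derivatives, of which an arbitrary representative
  is chosen. To compute with them, any weak derivative of a piecewise affine function has to be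
  identified almost everywhere with the constant slope of each triangle. Since weak derivatives of the
  basis functions exist by hypothesis, it is enough to use test functions supported
  inside a single open triangle (\<open>is_weak_deriv_affine_piece\<close>), which avoids integrating by parts
  across edges. This rests on the fundamental lemma of the calculus of variations, and hence on a supply of
  smooth bump functions.
\<close>

section \<open>Smooth functions and bumps\<close>

lemma C_k_SucI:
  assumes "\<And>p. (f has_derivative f' p) (at p)"
    and "\<And>e. e \<in> Basis \<Longrightarrow> C_k k (\<lambda>p. f' p e)"
  shows "C_k (Suc k) f"
proof -
  have "f' p = frechet_derivative f (at p)" for p
    using assms(1) by (rule frechet_derivative_at)
  then show ?thesis
    using assms by (auto simp: differentiable_def)
qed

lemma C_k_Suc_derivative:
  assumes "C_k (Suc k) f"
  shows "(f has_derivative frechet_derivative f (at p)) (at p)"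
  using assms by (simp add: frechet_derivative_works)

lemma C_k_imp_continuous_on:
  assumes "C_k k f"
  shows "continuous_on UNIV f"
  using assms
  by (cases k) (auto intro!: continuous_at_imp_continuous_on differentiable_imp_continuous_within)

lemma C_k_SucD: "C_k (Suc k) f \<Longrightarrow> C_k k f"
proof (induction k arbitrary: f)
  case 0
  then show ?case using C_k_imp_continuous_on by fastforce
next
  case (Suc k)
  then show ?case by auto
qed

lemma C_k_const: "C_k k (\<lambda>p. c)"
  by (induction k arbitrary: c) (auto simp: frechet_derivative_const)

lemma C_k_add:
  assumes "C_k k f" "C_k k g"
  shows "C_k k (\<lambda>p. f p + g p)"
  using assms
proof (induction k arbitrary: f g)
  case (Suc k)
  show ?case
  proof (rule C_k_SucI)
    show "((\<lambda>p. f p + g p) has_derivative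
        (\<lambda>e. frechet_derivative f (at p) e + frechet_derivative g (at p) e)) (at p)" for p
      using Suc.prems by (intro has_derivative_add C_k_Suc_derivative)
    show "C_k k (\<lambda>p. frechet_derivative f (at p) e + frechet_derivative g (at p) e)"
      if "e \<in> Basis" for e
      using Suc that by auto
  qed
qed (auto intro: continuous_intros)

lemma C_k_mult:
  assumes "C_k k f" "C_k k g"
  shows "C_k k (\<lambda>p. f p * g p)"
  using assms
proof (induction k arbitrary: f g)
  case (Suc k)
  show ?case
  proof (rule C_k_SucI)
    show "((\<lambda>p. f p * g p) has_derivative
        (\<lambda>e. f p * frechet_derivative g (at p) e + frechet_derivative f (at p) e * g p)) (at p)" for p
      using Suc.prems by (intro has_derivative_mult C_k_Suc_derivative)
    show "C_k k (\<lambda>p. f p * frechet_derivative g (at p) e + frechet_derivative f (at p) e * g p)"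
      if "e \<in> Basis" for e
      using Suc.prems that C_k_SucD by (intro C_k_add Suc.IH) auto
  qed
qed (auto intro: continuous_intros)

lemma C_k_prod:
  assumes "finite A" "\<And>i. i \<in> A \<Longrightarrow> C_k k (f i)"
  shows "C_k k (\<lambda>p. \<Prod>i\<in>A. f i p)"
  using assms by (induction A rule: finite_induct) (auto simp: C_k_const C_k_mult)

text \<open>
  The induction carries the whole sequence of successive derivatives: differentiating
  \<open>F j (p \<bullet> v + c)\<close> in a direction \<open>e\<close> yields \<open>F (Suc j) (p \<bullet> v + c)\<close> times the constant
  \<open>e \<bullet> v\<close>.
\<close>

lemma C_k_compose_affine:
  fixes F :: "nat \<Rightarrow> real \<Rightarrow> real"
  assumes "\<And>j s. (F j has_real_derivative F (Suc j) s) (at s)"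
  shows "C_k k (\<lambda>p::'a::euclidean_space. F j (p \<bullet> v + c))"
proof (induction k arbitrary: j)
  case 0
  have "continuous_on UNIV (F j)"
    using assms by (meson DERIV_isCont continuous_at_imp_continuous_on)
  then show ?case
    by (auto intro!: continuous_intros continuous_on_compose2[of UNIV "F j"])
next
  case (Suc k)
  show ?case
  proof (rule C_k_SucI)
    show "((\<lambda>p. F j (p \<bullet> v + c)) has_derivative (\<lambda>e. F (Suc j) (p \<bullet> v + c) * (e \<bullet> v))) (at p)"
      for p :: 'a
      by (rule has_derivative_compose[of "\<lambda>p. p \<bullet> v + c" "\<lambda>e. e \<bullet> v", 
            OF _ assms[unfolded has_field_derivative_def]]) (auto intro!: derivative_eq_intros)
    show "C_k k (\<lambda>p. F (Suc j) (p \<bullet> v + c) * (e \<bullet> v))" for e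
      by (intro C_k_mult Suc C_k_const)
  qed
qed

text \<open>
  For \<open>s > 0\<close>, the \<open>j\<close>-th derivative of \<open>exp (-1/s)\<close> is a polynomial in \<open>1/s\<close> times
  \<open>exp (-1/s)\<close>. The recursion for this polynomial is the product rule, the factor \<open>[:0, 0, 1:]\<close>
  coming from the inner derivative of \<open>1/s\<close>.
\<close>

primrec flat_poly :: "nat \<Rightarrow> real poly" where
  "flat_poly 0 = 1"
| "flat_poly (Suc j) = [:0, 0, 1:] * (flat_poly j - pderiv (flat_poly j))"

definition flat_exp :: "nat \<Rightarrow> real \<Rightarrow> real" where
  "flat_exp j s = (if s \<le> 0 then 0 else poly (flat_poly j) (1 / s) * exp (- (1 / s)))"

lemma poly_exp_tendsto_0: "((\<lambda>s. poly q s * exp (- s)) \<longlongrightarrow> 0) at_top" for q :: "real poly"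
proof -
  have "((\<lambda>s. \<Sum>i\<le>degree q. coeff q i * (s ^ i / exp s)) \<longlongrightarrow> (\<Sum>i\<le>degree q. coeff q i * 0)) at_top"
    by (intro tendsto_intros tendsto_power_div_exp_0)
  then show ?thesis
    by (simp add: poly_altdef sum_distrib_right exp_minus divide_inverse mult.assoc)
qed

text \<open>
  Only the origin is delicate: the difference quotient there is a polynomial in \<open>1/h\<close> times
  \<open>exp (-1/h)\<close> for \<open>h > 0\<close>, and exponential decay beats polynomial growth.
\<close>

lemma flat_exp_DERIV: "(flat_exp j has_real_derivative flat_exp (Suc j) s) (at s)"
proof -
  consider "s < 0" | "s > 0" | "s = 0" by linarith
  then show ?thesis
  proof cases
    case 1
    have "((\<lambda>s. 0) has_real_derivative flat_exp (Suc j) s) (at s)"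
      using 1 by (simp add: flat_exp_def)
    then show ?thesis
      by (rule has_field_derivative_transform_within_open[of _ _ _ "{..<0}"])
        (use 1 in \<open>auto simp: flat_exp_def\<close>)
  next
    case 2
    have "((\<lambda>s. poly (flat_poly j) (1 / s) * exp (- (1 / s))) has_real_derivative
        flat_exp (Suc j) s) (at s)"
      using 2 by (auto intro!: derivative_eq_intros DERIV_chain'[OF _ poly_DERIV]
          simp: flat_exp_def field_simps power2_eq_square)
    then show ?thesis
      by (rule has_field_derivative_transform_within_open[of _ _ _ "{0<..}"])
        (use 2 in \<open>auto simp: flat_exp_def\<close>)
  next
    case 3
    have "((\<lambda>h. flat_exp j h / h) \<longlongrightarrow> 0) (at_right 0)"
    proof -
      have "((\<lambda>h. poly ([:0, 1:] * flat_poly j) (inverse h) * exp (- inverse h)) \<longlongrightarrow> 0) (at_right 0)"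
        by (rule filterlim_compose[OF poly_exp_tendsto_0 filterlim_inverse_at_top_right])
      then show ?thesis
        by (rule Lim_transform_eventually)
          (auto intro!: eventually_at_right_less[THEN eventually_mono] simp: flat_exp_def field_simps)
    qed
    moreover have "((\<lambda>h. flat_exp j h / h) \<longlongrightarrow> 0) (at_left 0)"
      by (rule tendsto_eventually)
        (auto simp: eventually_at_filter flat_exp_def)
    ultimately have "((\<lambda>h. flat_exp j h / h) \<longlongrightarrow> 0) (at 0)"
      by (simp add: filterlim_split_at)
    then show ?thesis
      using 3 by (simp add: DERIV_def flat_exp_def)
  qed
qed

lemma flat_exp_nonneg: "0 \<le> flat_exp 0 s"
  and flat_exp_le_1: "flat_exp 0 s \<le> 1"
  by (auto simp: flat_exp_def)

lemma flat_exp_scaled_tendsto: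
  "(\<lambda>n. flat_exp 0 (real n * s)) \<longlonglongrightarrow> indicator {0<..} s"
proof (cases "s > 0")
  case True
  have "(\<lambda>n. exp (- ((1 / s) * inverse (real n)))) \<longlonglongrightarrow> exp (- ((1 / s) * 0))"
    by (intro tendsto_intros lim_inverse_n)
  moreover have "\<forall>\<^sub>F n in sequentially. exp (- ((1 / s) * inverse (real n))) = flat_exp 0 (real n * s)"
    using eventually_gt_at_top[of 0] by eventually_elim (use True in \<open>auto simp: flat_exp_def field_simps mult_le_0_iff\<close>)
  ultimately show ?thesis
    using True by (simp add: Lim_transform_eventually)
next
  case False
  then have "flat_exp 0 (real n * s) = 0" for n
    by (auto simp: flat_exp_def mult_le_0_iff not_less)
  with False show ?thesis by simp
qed

text \<open>
  A smooth approximation from below of the indicator of \<open>box a b\<close>: as \<open>n\<close> grows,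
  \<open>flat_exp 0 (n s)\<close> tends to \<open>1\<close> for \<open>s > 0\<close> and stays \<open>0\<close> for \<open>s \<le> 0\<close>.
\<close>

definition box_bump :: "nat \<Rightarrow> 'a::euclidean_space \<Rightarrow> 'a \<Rightarrow> 'a \<Rightarrow> real" where
  "box_bump n a b p =
     (\<Prod>i\<in>Basis. flat_exp 0 (real n * (p \<bullet> i - a \<bullet> i)) * flat_exp 0 (real n * (b \<bullet> i - p \<bullet> i)))"

lemma C_k_box_bump: "C_k k (box_bump n a b)"
proof -
  have "C_k k (\<lambda>p. flat_exp 0 (real n * (p \<bullet> i - a \<bullet> i)))" for i :: 'a
    using C_k_compose_affine[of flat_exp, OF flat_exp_DERIV, of k 0 "real n *\<^sub>R i" "- real n * (a \<bullet> i)"]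
    by (simp add: algebra_simps)
  moreover have "C_k k (\<lambda>p. flat_exp 0 (real n * (b \<bullet> i - p \<bullet> i)))" for i :: 'a
    using C_k_compose_affine[of flat_exp, OF flat_exp_DERIV, of k 0 "- real n *\<^sub>R i" "real n * (b \<bullet> i)"]
    by (simp add: algebra_simps)
  ultimately show ?thesis
    unfolding box_bump_def[abs_def] by (intro C_k_prod C_k_mult) auto
qed

lemma box_bump_nonneg: "0 \<le> box_bump n a b p"
  unfolding box_bump_def by (intro prod_nonneg) (simp add: flat_exp_nonneg)

lemma box_bump_le_1: "box_bump n a b p \<le> 1"
  unfolding box_bump_def
  by (intro prod_le_1) (simp add: flat_exp_nonneg flat_exp_le_1 mult_le_one)

lemma box_bump_eq_0:
  assumes "p \<notin> box a b"
  shows "box_bump n a b p = 0"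
proof -
  from assms obtain i where "i \<in> Basis" "p \<bullet> i \<le> a \<bullet> i \<or> b \<bullet> i \<le> p \<bullet> i"
    by (auto simp: mem_box not_less)
  then show ?thesis
    unfolding box_bump_def
    by (intro prod_zero bexI[of _ i]) (auto simp: flat_exp_def mult_nonneg_nonpos)
qed

lemma box_bump_tendsto: "(\<lambda>n. box_bump n a b p) \<longlonglongrightarrow> indicator (box a b) p"
proof -
  have "(\<lambda>n. box_bump n a b p) \<longlonglongrightarrow>
      (\<Prod>i\<in>Basis. indicator {0<..} (p \<bullet> i - a \<bullet> i) * indicator {0<..} (b \<bullet> i - p \<bullet> i))"
    unfolding box_bump_def by (intro tendsto_intros flat_exp_scaled_tendsto)
  also have "(\<Prod>i\<in>Basis. indicator {0<..} (p \<bullet> i - a \<bullet> i) * indicator {0<..} (b \<bullet> i - p \<bullet> i))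
      = (indicator (box a b) p :: real)"
    by (auto simp: indicator_def mem_box intro!: prod.neutral)
  finally show ?thesis .
qed

lemma box_bump_test_function:
  assumes "cbox a b \<subseteq> S"
  shows "box_bump n a b \<in> test_functions S"
proof -
  have "{p. box_bump n a b p \<noteq> 0} \<subseteq> cbox a b"
    using box_bump_eq_0 box_subset_cbox by blast
  then have "closure {p. box_bump n a b p \<noteq> 0} \<subseteq> cbox a b"
    by (rule closure_minimal) (rule closed_cbox)
  moreover from this have "compact (closure {p. box_bump n a b p \<noteq> 0})"
    using compact_cbox compact_closure bounded_cbox bounded_subset closure_subset by blast
  ultimately show ?thesis
    using assms by (auto simp: test_functions_def C_k_box_bump)
qed

section \<open>Integrals against test functions\<close>

lemma test_function_derivative:
  assumes "\<psi> \<in> test_functions S"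
  shows "(\<psi> has_derivative frechet_derivative \<psi> (at p)) (at p)"
proof -
  have "C_k (Suc 0) \<psi>"
    using assms by (auto simp: test_functions_def simp del: C_k.simps)
  then show ?thesis by (rule C_k_Suc_derivative)
qed

lemma test_functions_mono: "S \<subseteq> T \<Longrightarrow> test_functions S \<subseteq> test_functions T"
  by (auto simp: test_functions_def)

lemma frechet_derivative_outside_support:
  assumes "p \<notin> closure {p. f p \<noteq> 0}"
  shows "frechet_derivative f (at p) = (\<lambda>e. 0)"
proof -
  have "((\<lambda>p. 0) has_derivative (\<lambda>e. 0)) (at p)"
    by simp
  then have "(f has_derivative (\<lambda>e. 0)) (at p)"
    by (rule has_derivative_transform_within_open[of _ _ _ "UNIV" "- closure {p. f p \<noteq> 0}"])
      (use assms closure_subset[of "{p. f p \<noteq> 0}"] in auto)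
  then show ?thesis
    by (simp add: frechet_derivative_at[symmetric])
qed

lemma integrable_continuous_compact_support:
  fixes f :: "'a::euclidean_space \<Rightarrow> real"
  assumes "continuous_on UNIV f" "compact C" "\<And>p. p \<notin> C \<Longrightarrow> f p = 0"
  shows "integrable lborel f"
proof -
  have "integrable lborel (\<lambda>p. indicator C p *\<^sub>R f p)"
    using assms by (intro borel_integrable_compact continuous_on_subset[OF assms(1)]) auto
  moreover have "(\<lambda>p. indicator C p *\<^sub>R f p) = f"
    by (rule ext) (metis assms(3) indicator_simps(1,2) scaleR_one scaleR_zero_left)
  ultimately show ?thesis by simp
qed

lemma lborel_integral_translation:
  fixes f :: "'a::euclidean_space \<Rightarrow> real"
  assumes "f \<in> borel_measurable borel"
  shows "(LINT p|lborel. f (p + v)) = (LINT p|lborel. f p)"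
proof -
  have "(LINT p|lborel. f p) = (LINT p|distr lborel borel ((+) v). f p)"
    by (simp add: lborel_distr_plus)
  also have "\<dots> = (LINT p|lborel. f (v + p))"
    using assms by (subst integral_distr) auto
  finally show ?thesis by (simp add: add.commute)
qed

text \<open>
  The difference quotients of \<open>f\<close> in direction \<open>e\<close> have integral zero because Lebesgue measure is
  translation invariant. By the mean value theorem they are bounded, and they vanish outside one
  large ball, so dominated convergence passes to the derivative.
\<close>

lemma integral_directional_derivative_eq_0:
  fixes f :: "'a::euclidean_space \<Rightarrow> real"
  assumes diff: "\<And>p. (f has_derivative f' p) (at p)"
    and cont: "continuous_on UNIV (\<lambda>p. f' p e)"
    and C: "compact C" and supp: "\<And>p. p \<notin> C \<Longrightarrow> f p = 0" "\<And>p. p \<notin> C \<Longrightarrow> f' p e = 0"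
  shows "(LINT p|lborel. f' p e) = 0"
proof -
  have contf: "continuous_on UNIV f"
    using diff by (meson continuous_at_imp_continuous_on has_derivative_continuous)
  then have bm: "f \<in> borel_measurable borel"
    by (rule borel_measurable_continuous_onI)
  have intf: "integrable lborel f"
    using contf C supp(1) by (rule integrable_continuous_compact_support)
  define t where "t n = inverse (real (Suc n))" for n
  have t: "0 < t n" "t n \<le> 1" for n
    by (auto simp: t_def inverse_le_1_iff)
  have "t \<longlonglongrightarrow> 0"
    unfolding t_def by (rule LIMSEQ_inverse_real_of_nat)
  define q where "q n p = (f (p + t n *\<^sub>R e) - f p) / t n" for n p
  obtain B where B: "\<And>p. \<bar>f' p e\<bar> \<le> B"
  proof -
    have "compact ((\<lambda>p. f' p e) ` C)"
      using C by (intro compact_continuous_image continuous_on_subset[OF cont]) auto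
    then obtain b where b: "\<forall>y\<in>(\<lambda>p. f' p e) ` C. norm y \<le> b"
      using compact_imp_bounded bounded_iff by metis
    have "\<bar>f' p e\<bar> \<le> max b 0" for p
      using b supp(2)[of p] by (cases "p \<in> C") force+
    then show ?thesis using that by blast
  qed
  obtain r where r: "\<And>p. p \<in> C \<Longrightarrow> norm p \<le> r"
    using compact_imp_bounded[OF C] bounded_iff by metis
  define D where "D = cball (0::'a) (r + norm e)"
  have line: "((\<lambda>s. f (p + s *\<^sub>R e)) has_real_derivative f' (p + s *\<^sub>R e) e) (at s)" for p s
  proof -
    have "((\<lambda>s. f (p + s *\<^sub>R e)) has_derivative (\<lambda>h. f' (p + s *\<^sub>R e) (h *\<^sub>R e))) (at s)"
      by (rule has_derivative_compose[OF _ diff]) (auto intro!: derivative_eq_intros)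
    moreover have "(\<lambda>h. f' (p + s *\<^sub>R e) (h *\<^sub>R e)) = (*) (f' (p + s *\<^sub>R e) e)"
      using linear_scale[OF has_derivative_linear[OF diff]] by auto
    ultimately show ?thesis
      by (simp add: has_field_derivative_def)
  qed
  have int_q: "(LINT p|lborel. q n p) = 0" for n
  proof -
    have "integrable lborel (\<lambda>p. f (p + t n *\<^sub>R e))"
    proof (rule integrable_continuous_compact_support)
      show "continuous_on UNIV (\<lambda>p. f (p + t n *\<^sub>R e))"
        by (rule continuous_on_compose2[OF contf]) (auto intro!: continuous_intros)
      show "compact ((\<lambda>p. p - t n *\<^sub>R e) ` C)"
        using C by (intro compact_continuous_image continuous_intros)
      show "f (p + t n *\<^sub>R e) = 0" if "p \<notin> (\<lambda>p. p - t n *\<^sub>R e) ` C" for p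
        using that supp(1) by (metis add_diff_cancel_right' imageI)
    qed
    then show ?thesis
      using intf lborel_integral_translation[OF bm, of "t n *\<^sub>R e"] by (simp add: q_def)
  qed
  have "(\<lambda>n. LINT p|lborel. q n p) \<longlonglongrightarrow> (LINT p|lborel. f' p e)"
  proof (rule integral_dominated_convergence[where w = "\<lambda>p. B * indicator D p"])
    show "(\<lambda>p. f' p e) \<in> borel_measurable lborel"
      using borel_measurable_continuous_onI[OF cont] by simp
    show "q n \<in> borel_measurable lborel" for n
      unfolding q_def using bm by simp
    show "integrable lborel (\<lambda>p. B * indicator D p)"
      unfolding D_def
      by (intro integrable_mult_right integrable_real_indicator emeasure_bounded_finite bounded_cball) simp
    show "AE p in lborel. (\<lambda>n. q n p) \<longlonglongrightarrow> f' p e"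
    proof (rule AE_I2)
      fix p
      have "((\<lambda>h. (f (p + h *\<^sub>R e) - f p) / h) \<longlongrightarrow> f' p e) (at 0)"
        using line[of p 0] by (simp add: DERIV_def)
      moreover have "filterlim t (at 0) sequentially"
        using \<open>t \<longlonglongrightarrow> 0\<close> t(1) by (auto simp: filterlim_at less_imp_neq[THEN not_sym] intro!: always_eventually)
      ultimately show "(\<lambda>n. q n p) \<longlonglongrightarrow> f' p e"
        unfolding q_def by (rule filterlim_compose)
    qed
    show "AE p in lborel. norm (q n p) \<le> B * indicator D p" for n
    proof (rule AE_I2)
      fix p
      show "norm (q n p) \<le> B * indicator D p"
      proof (cases "p \<in> D")
        case True
        obtain z where "f (p + t n *\<^sub>R e) - f (p + 0 *\<^sub>R e) = (t n - 0) * f' (p + z *\<^sub>R e) e"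
          using MVT2[OF t(1)[of n], of "\<lambda>s. f (p + s *\<^sub>R e)" "\<lambda>s. f' (p + s *\<^sub>R e) e"] line by blast
        then have "q n p = f' (p + z *\<^sub>R e) e"
          using t(1)[of n] by (simp add: q_def)
        with B True show ?thesis by simp
      next
        case False
        have "p \<notin> C"
          using False r[of p] norm_ge_zero[of e] by (force simp: D_def)
        moreover have "p + t n *\<^sub>R e \<notin> C"
        proof
          assume "p + t n *\<^sub>R e \<in> C"
          then have "norm (p + t n *\<^sub>R e) \<le> r" by (rule r)
          moreover have "norm p \<le> norm (p + t n *\<^sub>R e) + norm (t n *\<^sub>R e)"
            using norm_triangle_ineq4[of "p + t n *\<^sub>R e" "t n *\<^sub>R e"] by simp
          moreover have "norm (t n *\<^sub>R e) \<le> norm e"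
            using t[of n] mult_right_mono[of "t n" 1 "norm e"] by simp
          ultimately show False
            using False by (simp add: D_def)
        qed
        ultimately show ?thesis
          using False supp(1) by (simp add: q_def)
      qed
    qed
  qed
  then show ?thesis
    by (simp add: int_q LIMSEQ_const_iff)
qed

section \<open>The fundamental lemma of the calculus of variations\<close>

lemma integral_lebesgue_on_cong_support:
  fixes f :: "'a::euclidean_space \<Rightarrow> real"
  assumes "S \<in> sets lebesgue" "T \<in> sets lebesgue" "T \<subseteq> S" "\<And>p. p \<in> S - T \<Longrightarrow> f p = 0"
  shows "(LINT p|lebesgue_on S. f p) = (LINT p|lebesgue_on T. f p)"
proof -
  have "(\<lambda>p. indicator S p *\<^sub>R f p) = (\<lambda>p. indicator T p *\<^sub>R f p)"
    using assms(3,4) by (fastforce simp: indicator_def)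
  then show ?thesis
    using assms(1,2) by (simp add: integral_restrict_space)
qed

lemma absolutely_integrable_on_iff_integrable:
  fixes f :: "'a::euclidean_space \<Rightarrow> real"
  assumes "S \<in> sets lebesgue"
  shows "f absolutely_integrable_on S \<longleftrightarrow> integrable (lebesgue_on S) f"
  using assms by (simp add: set_integrable_def integrable_restrict_space)

text \<open>
  The bumps of \<open>box a b\<close> are admissible test functions and converge boundedly to its indicator.
\<close>

lemma integral_box_eq_0_if_test_integrals_0:
  fixes h :: "'a::euclidean_space \<Rightarrow> real"
  assumes S: "open S" and box: "cbox a b \<subseteq> S" and h: "locally_integrable S h"
    and test: "\<And>\<psi>. \<psi> \<in> test_functions S \<Longrightarrow> (LINT p|lebesgue_on S. h p * \<psi> p) = 0"
  shows "integral (cbox a b) h = 0"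
proof -
  let ?M = "lebesgue_on (cbox a b)"
  have h': "integrable ?M h"
    using h box by (auto simp: locally_integrable_def simp flip: absolutely_integrable_on_iff_integrable)
  have [measurable]: "h \<in> borel_measurable ?M"
    using h' by (rule borel_measurable_integrable)
  have meas_bump [measurable]: "box_bump n a b \<in> borel_measurable ?M" for n
  proof -
    have "box_bump n a b \<in> borel_measurable lebesgue"
      using borel_measurable_continuous_onI[OF C_k_imp_continuous_on[OF C_k_box_bump[of 0]]]
      by (intro measurable_completion) simp
    then show ?thesis by (rule measurable_restrict_space1)
  qed
  have [measurable]: "indicator (box a b) \<in> borel_measurable ?M"
    using box_subset_cbox[of a b]
    by (intro borel_measurable_indicator) (auto simp: sets_restrict_space_iff)
  have "(\<lambda>n. LINT p|?M. h p * box_bump n a b p) \<longlonglongrightarrow> (LINT p|?M. h p * indicator (box a b) p)"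
  proof (rule integral_dominated_convergence[where w = "\<lambda>p. \<bar>h p\<bar>"])
    show "AE p in ?M. (\<lambda>n. h p * box_bump n a b p) \<longlonglongrightarrow> h p * indicator (box a b) p"
      by (intro AE_I2 tendsto_intros box_bump_tendsto)
    show "AE p in ?M. norm (h p * box_bump n a b p) \<le> \<bar>h p\<bar>" for n
      using box_bump_nonneg[of n a b] box_bump_le_1[of n a b]
      by (auto intro!: AE_I2 mult_left_le simp: abs_mult)
    show "integrable ?M (\<lambda>p. \<bar>h p\<bar>)"
      using h' by simp
  qed measurable
  moreover have "(LINT p|?M. h p * box_bump n a b p) = 0" for n
  proof -
    have "box_bump n a b p = 0" if "p \<notin> cbox a b" for p
      using that box_subset_cbox by (blast intro: box_bump_eq_0)
    then have "(LINT p|lebesgue_on S. h p * box_bump n a b p) = (LINT p|?M. h p * box_bump n a b p)"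
      using S box by (intro integral_lebesgue_on_cong_support) auto
    then show ?thesis
      using test[OF box_bump_test_function[OF box], of n] by simp
  qed
  ultimately have "(LINT p|?M. h p * indicator (box a b) p) = 0"
    by (simp add: LIMSEQ_const_iff)
  also have "(LINT p|?M. h p * indicator (box a b) p) = (LINT p|lebesgue_on (box a b). h p)"
  proof -
    have "(LINT p|?M. h p * indicator (box a b) p) = (LINT p|lebesgue_on (box a b). h p * indicator (box a b) p)"
      using box_subset_cbox[of a b] by (intro integral_lebesgue_on_cong_support) auto
    also have "\<dots> = (LINT p|lebesgue_on (box a b). h p)"
      by (intro Bochner_Integration.integral_cong) auto
    finally show ?thesis .
  qed
  also have "\<dots> = integral (box a b) h"
  proof (rule lebesgue_integral_eq_integral)
    have "h absolutely_integrable_on cbox a b"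
      using h box by (auto simp: locally_integrable_def)
    then have "h absolutely_integrable_on box a b"
      by (rule set_integrable_subset) (use box_subset_cbox in auto)
    then show "integrable (lebesgue_on (box a b)) h"
      by (simp add: absolutely_integrable_on_iff_integrable)
  qed simp
  finally show ?thesis
    by (simp add: integral_open_interval)
qed

text \<open>
  At almost every point the value of \<open>h\<close> is the limit of its averages over the small cubes having that point
  as lower corner, and all these averages vanish.
\<close>

lemma negligible_nonzero_if_box_integrals_0:
  fixes h :: "'a::euclidean_space \<Rightarrow> real"
  assumes h: "h absolutely_integrable_on cbox a b"
    and int0: "\<And>c d. cbox c d \<subseteq> cbox a b \<Longrightarrow> integral (cbox c d) h = 0"
  shows "negligible {p \<in> box a b. h p \<noteq> 0}"
proof -
  define f where "f p = (if p \<in> cbox a b then h p else 0)" for p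
  have "h integrable_on cbox a b"
    using h by (rule set_lebesgue_integral_eq_integral)
  then have "f integrable_on UNIV"
    unfolding f_def by (simp only: integrable_restrict_UNIV)
  then have "f integrable_on cbox c d" for c d
    using integrable_on_subcbox by blast
  then obtain N where N: "negligible N" and lim: "\<And>x e. \<lbrakk>x \<notin> N; 0 < e\<rbrakk> \<Longrightarrow>
      \<exists>d>0. \<forall>t. 0 < t \<and> t < d \<longrightarrow>
        norm (integral (cbox x (x + t *\<^sub>R One)) f /\<^sub>R t ^ DIM('a) - f x) < e"
    using integrable_ccontinuous_explicit by blast
  have "h x = 0" if x: "x \<in> box a b" "x \<notin> N" for x
  proof (rule ccontr)
    assume "h x \<noteq> 0"
    have fx: "f x = h x"
      using x(1) box_subset_cbox by (auto simp: f_def)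
    with \<open>h x \<noteq> 0\<close> have "0 < \<bar>f x\<bar>" by simp
    then obtain d where d: "d > 0" "\<And>t. 0 < t \<Longrightarrow> t < d \<Longrightarrow>
        norm (integral (cbox x (x + t *\<^sub>R One)) f /\<^sub>R t ^ DIM('a) - f x) < \<bar>f x\<bar>"
      using lim[OF x(2)] by blast
    obtain \<delta> where \<delta>: "\<delta> > 0" "cball x \<delta> \<subseteq> box a b"
      using open_contains_cball[of "box a b"] x(1) open_box by blast
    \<comment> \<open>The side \<open>t\<close> is small enough that the cube at \<open>x\<close> stays in the box.\<close>
    define m where "m = norm (One::'a) + 1"
    have m: "0 < m" "norm (One::'a) \<le> m"
      using norm_ge_zero[of "One::'a"] unfolding m_def by linarith+
    define t where "t = min (d / 2) (\<delta> / m)"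
    have t: "0 < t" "t < d" "t \<le> \<delta> / m"
      using d(1) divide_pos_pos[OF \<delta>(1) m(1)] unfolding t_def by linarith+
    have "t * norm (One::'a) \<le> (\<delta> / m) * m"
      using t m by (intro mult_mono) auto
    then have "x + t *\<^sub>R One \<in> cball x \<delta>"
      using t(1) m(1) by (simp add: dist_norm)
    then have "x + t *\<^sub>R One \<in> cbox a b"
      using \<delta>(2) box_subset_cbox by blast
    then have sub: "cbox x (x + t *\<^sub>R One) \<subseteq> cbox a b"
      using x(1) by (auto simp: subset_box mem_box less_imp_le)
    have "integral (cbox x (x + t *\<^sub>R One)) f = integral (cbox x (x + t *\<^sub>R One)) h"
      using sub by (intro integral_cong) (auto simp: f_def)
    also have "\<dots> = 0"
      using sub by (rule int0)
    finally show False
      using d(2)[OF t(1,2)] by simp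
  qed
  then have "{p \<in> box a b. h p \<noteq> 0} \<subseteq> N" by blast
  with N show ?thesis by (rule negligible_subset)
qed

text \<open>
  An open set is a countable union of closed boxes, whose boundaries are null sets, so the
  statement on boxes suffices.
\<close>

lemma fundamental_lemma_calculus_of_variations:
  fixes h :: "'a::euclidean_space \<Rightarrow> real"
  assumes S: "open S" and h: "locally_integrable S h"
    and test: "\<And>\<psi>. \<psi> \<in> test_functions S \<Longrightarrow> (LINT p|lebesgue_on S. h p * \<psi> p) = 0"
  shows "negligible {p \<in> S. h p \<noteq> 0}"
proof -
  obtain \<D> where \<D>: "countable \<D>" "\<D> \<subseteq> Pow S"
    "\<And>X. X \<in> \<D> \<Longrightarrow> \<exists>a b. X = cbox a b" "\<Union>\<D> = S"
    using open_countable_Union_open_cbox[OF S] by blast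
  have "negligible {p \<in> X. h p \<noteq> 0}" if X: "X \<in> \<D>" for X
  proof -
    obtain a b where ab: "X = cbox a b" using \<D>(3) X by blast
    then have sub: "cbox a b \<subseteq> S" using \<D>(2) X by blast
    have "negligible {p \<in> box a b. h p \<noteq> 0}"
    proof (rule negligible_nonzero_if_box_integrals_0)
      show "h absolutely_integrable_on cbox a b"
        using h sub by (simp add: locally_integrable_def)
      show "integral (cbox c d) h = 0" if "cbox c d \<subseteq> cbox a b" for c d
        using that sub by (intro integral_box_eq_0_if_test_integrals_0[OF S _ h test]) auto
    qed
    moreover have "negligible (cbox a b - box a b)"
      by (rule negligible_frontier_interval)
    ultimately have "negligible ({p \<in> box a b. h p \<noteq> 0} \<union> (cbox a b - box a b))"
      by (rule negligible_Un)
    then show ?thesis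
      by (rule negligible_subset) (auto simp: ab)
  qed
  then have "negligible (\<Union>X\<in>\<D>. {p \<in> X. h p \<noteq> 0})"
    using \<D>(1) by (intro negligible_countable_Union) auto
  moreover have "(\<Union>X\<in>\<D>. {p \<in> X. h p \<noteq> 0}) = {p \<in> S. h p \<noteq> 0}"
    using \<D>(4) by blast
  ultimately show ?thesis by simp
qed


section \<open>Weak derivatives of piecewise affine functions\<close>

text \<open>
  All integrands in the definition of a weak derivative have this form; their integrability is what
  allows splitting the integrals.
\<close>

lemma integrable_locally_integrable_mult:
  fixes g \<psi> :: "'a::euclidean_space \<Rightarrow> real"
  assumes g: "locally_integrable S g" and S: "S \<in> sets lebesgue"
    and \<psi>: "continuous_on UNIV \<psi>" and C: "compact C" "C \<subseteq> S" "\<And>p. p \<notin> C \<Longrightarrow> \<psi> p = 0"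
  shows "integrable (lebesgue_on S) (\<lambda>p. g p * \<psi> p)"
proof -
  have "g absolutely_integrable_on C"
    using g C by (simp add: locally_integrable_def)
  moreover have "bounded (\<psi> ` C)"
    by (intro compact_imp_bounded compact_continuous_image continuous_on_subset[OF \<psi>] C) auto
  moreover have "\<psi> \<in> borel_measurable (lebesgue_on C)"
    by (rule continuous_imp_measurable_on_sets_lebesgue)
      (use C \<psi> in \<open>auto intro: continuous_on_subset lmeasurable_compact fmeasurableD\<close>)
  moreover have CL: "C \<in> sets lebesgue"
    using C(1) lmeasurable_compact fmeasurableD by blast
  ultimately have "(\<lambda>p. \<psi> p * g p) absolutely_integrable_on C"
    by (intro absolutely_integrable_bounded_measurable_product[OF bilinear_times])
  then have "integrable (lebesgue_on C) (\<lambda>p. \<psi> p * g p)"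
    using CL by (simp add: absolutely_integrable_on_iff_integrable)
  then have "integrable lebesgue (\<lambda>p. indicator C p *\<^sub>R (\<psi> p * g p))"
    using CL by (simp add: integrable_restrict_space)
  also have "(\<lambda>p. indicator C p *\<^sub>R (\<psi> p * g p)) = (\<lambda>p. indicator S p *\<^sub>R (g p * \<psi> p))"
    using C(2,3) by (fastforce simp: indicator_def)
  finally show ?thesis
    using S by (simp add: integrable_restrict_space)
qed

lemma test_functionE:
  assumes "\<psi> \<in> test_functions S"
  obtains C where "compact C" "C \<subseteq> S" "\<And>p. p \<notin> C \<Longrightarrow> \<psi> p = 0"
    "\<And>p e. p \<notin> C \<Longrightarrow> frechet_derivative \<psi> (at p) e = 0"
proof
  let ?C = "closure {p. \<psi> p \<noteq> 0}"
  show "compact ?C" "?C \<subseteq> S"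
    using assms by (auto simp: test_functions_def simp del: compact_closure)
  show "\<psi> p = 0" if "p \<notin> ?C" for p
    using that closure_subset[of "{p. \<psi> p \<noteq> 0}"] by blast
  show "frechet_derivative \<psi> (at p) e = 0" if "p \<notin> ?C" for p e
    using frechet_derivative_outside_support[OF that] by simp
qed

lemma continuous_on_test_function:
  assumes "\<psi> \<in> test_functions S"
  shows "continuous_on UNIV \<psi>"
proof -
  have "C_k 0 \<psi>" using assms by (auto simp: test_functions_def simp del: C_k.simps)
  then show ?thesis by (rule C_k_imp_continuous_on)
qed

lemma continuous_on_test_function_derivative:
  assumes "\<psi> \<in> test_functions S" "e \<in> Basis"
  shows "continuous_on UNIV (\<lambda>p. frechet_derivative \<psi> (at p) e)"
proof -
  have "C_k (Suc 0) \<psi>" using assms by (auto simp: test_functions_def simp del: C_k.simps)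
  then show ?thesis using assms(2) by simp
qed

lemma is_weak_deriv_sum:
  fixes u g :: "'m \<Rightarrow> 'a::euclidean_space \<Rightarrow> real"
  assumes S: "S \<in> sets lebesgue" and e: "e \<in> Basis" and I: "finite I"
    and u: "\<And>i. i \<in> I \<Longrightarrow> is_weak_deriv S e (u i) (g i)"
  shows "is_weak_deriv S e (\<lambda>p. \<Sum>i\<in>I. c i * u i p) (\<lambda>p. \<Sum>i\<in>I. c i * g i p)"
  unfolding is_weak_deriv_def
proof (intro conjI ballI)
  have loc: "locally_integrable S (u i)" "locally_integrable S (g i)" if "i \<in> I" for i
    using u[OF that] by (auto simp: is_weak_deriv_def)
  show "locally_integrable S (\<lambda>p. \<Sum>i\<in>I. c i * u i p)" "locally_integrable S (\<lambda>p. \<Sum>i\<in>I. c i * g i p)"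
    using I loc by (auto simp: locally_integrable_def intro!: absolutely_integrable_sum)
  fix \<psi> assume \<psi>: "\<psi> \<in> test_functions S"
  then obtain C where C: "compact C" "C \<subseteq> S" "\<And>p. p \<notin> C \<Longrightarrow> \<psi> p = 0"
    "\<And>p e. p \<notin> C \<Longrightarrow> frechet_derivative \<psi> (at p) e = 0"
    using test_functionE[OF \<psi>] by blast
  let ?D = "\<lambda>p. frechet_derivative \<psi> (at p) e"
  have int: "integrable (lebesgue_on S) (\<lambda>p. u i p * ?D p)" "integrable (lebesgue_on S) (\<lambda>p. g i p * \<psi> p)"
    if "i \<in> I" for i
    using loc[OF that] C S continuous_on_test_function[OF \<psi>] continuous_on_test_function_derivative[OF \<psi> e]
    by (auto intro!: integrable_locally_integrable_mult)
  have "(LINT p|lebesgue_on S. (\<Sum>i\<in>I. c i * u i p) * ?D p)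
      = (\<Sum>i\<in>I. c i * (LINT p|lebesgue_on S. u i p * ?D p))"
    using int by (simp add: sum_distrib_right mult.assoc)
  also have "\<dots> = (\<Sum>i\<in>I. c i * - (LINT p|lebesgue_on S. g i p * \<psi> p))"
    using u \<psi> by (intro sum.cong) (auto simp: is_weak_deriv_def)
  also have "\<dots> = - (LINT p|lebesgue_on S. (\<Sum>i\<in>I. c i * g i p) * \<psi> p)"
    using int by (simp add: sum_distrib_right mult.assoc sum_negf)
  finally show "(LINT p|lebesgue_on S. (\<Sum>i\<in>I. c i * u i p) * ?D p)
    = - (LINT p|lebesgue_on S. (\<Sum>i\<in>I. c i * g i p) * \<psi> p)" .
qed

lemma is_weak_deriv_weak_deriv:
  "is_weak_deriv S e u g \<Longrightarrow> is_weak_deriv S e u (weak_deriv S e u)"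
  unfolding weak_deriv_def by (rule someI[of "is_weak_deriv S e u"])

text \<open>
  A test function supported in \<open>T\<close> sees only the affine function, so both sides of the defining
  identity are integrals of smooth functions with compact support, and the product rule together with
  \<open>integral_directional_derivative_eq_0\<close> replaces integration by parts. The fundamental
  lemma then determines the weak derivative on \<open>T\<close>.
\<close>

lemma is_weak_deriv_affine_piece:
  fixes u :: "'a::euclidean_space \<Rightarrow> real"
  assumes S: "S \<in> sets lebesgue" and T: "open T" "T \<subseteq> S" and e: "e \<in> Basis"
    and weak: "is_weak_deriv S e u g" and affine: "\<And>p. p \<in> T \<Longrightarrow> u p = p \<bullet> v + c"
  shows "negligible {p \<in> T. g p \<noteq> e \<bullet> v}"
proof -
  have TL: "T \<in> sets lebesgue"
    using T(1) by auto
  have locg: "locally_integrable T g"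
    using weak T by (auto simp: is_weak_deriv_def locally_integrable_def)
  have "negligible {p \<in> T. g p - e \<bullet> v \<noteq> 0}"
  proof (rule fundamental_lemma_calculus_of_variations[OF T(1)])
    show "locally_integrable T (\<lambda>p. g p - e \<bullet> v)"
      using locg by (auto simp: locally_integrable_def intro!: set_integral_diff absolutely_integrable_on_const lmeasurable_compact)
  next
    fix \<psi> assume \<psi>: "\<psi> \<in> test_functions T"
    then have \<psi>S: "\<psi> \<in> test_functions S"
      using test_functions_mono[OF T(2)] by blast
    obtain C where C: "compact C" "C \<subseteq> T" "\<And>p. p \<notin> C \<Longrightarrow> \<psi> p = 0"
      "\<And>p e. p \<notin> C \<Longrightarrow> frechet_derivative \<psi> (at p) e = 0"
      using test_functionE[OF \<psi>] by blast
    let ?D = "\<lambda>p. frechet_derivative \<psi> (at p) e"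
    let ?f = "\<lambda>p. (p \<bullet> v + c) * ?D p"
    have cont: "continuous_on UNIV \<psi>" "continuous_on UNIV ?D"
      using \<psi> e by (auto intro: continuous_on_test_function continuous_on_test_function_derivative)
    then have int: "integrable lborel ?f" "integrable lborel \<psi>"
      using C by (auto intro!: integrable_continuous_compact_support[of _ C] continuous_intros)
    have "(LINT p|lborel. (p \<bullet> v + c) * ?D p + (e \<bullet> v) * \<psi> p) = 0"
    proof (rule integral_directional_derivative_eq_0[where f = "\<lambda>p. (p \<bullet> v + c) * \<psi> p"
          and f' = "\<lambda>p e. (p \<bullet> v + c) * frechet_derivative \<psi> (at p) e + (e \<bullet> v) * \<psi> p"])
      show "((\<lambda>p. (p \<bullet> v + c) * \<psi> p) has_derivative
          (\<lambda>e. (p \<bullet> v + c) * frechet_derivative \<psi> (at p) e + (e \<bullet> v) * \<psi> p)) (at p)" for p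
        by (intro has_derivative_mult test_function_derivative[OF \<psi>])
          (auto intro!: derivative_eq_intros)
      show "continuous_on UNIV (\<lambda>p. (p \<bullet> v + c) * ?D p + (e \<bullet> v) * \<psi> p)"
        by (intro continuous_intros cont)
      show "compact C" by fact
    qed (use C in auto)
    then have parts: "(LINT p|lborel. ?f p) = - (e \<bullet> v) * (LINT p|lborel. \<psi> p)"
      using int by simp
    have lint: "(LINT p|lebesgue_on T. f p) = (LINT p|lborel. f p)"
      if "integrable lborel f" "\<And>p. p \<notin> C \<Longrightarrow> f p = 0" for f :: "'a \<Rightarrow> real"
    proof -
      have "(LINT p|lebesgue_on UNIV. f p) = (LINT p|lebesgue_on T. f p)"
        using TL that C(2) by (intro integral_lebesgue_on_cong_support) auto
      then show ?thesis
        using that(1) by (simp add: lebesgue_on_UNIV_eq integral_completion)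
    qed
    have "(LINT p|lebesgue_on T. ?f p) = (LINT p|lebesgue_on T. u p * ?D p)"
      using affine by (intro Bochner_Integration.integral_cong) auto
    also have "\<dots> = (LINT p|lebesgue_on S. u p * ?D p)"
    proof (rule integral_lebesgue_on_cong_support[symmetric, OF S TL T(2)])
      show "u p * ?D p = 0" if "p \<in> S - T" for p
        using that C(2) C(4)[of p e] by auto
    qed
    also have "\<dots> = - (LINT p|lebesgue_on S. g p * \<psi> p)"
      using weak \<psi>S by (simp add: is_weak_deriv_def)
    also have "(LINT p|lebesgue_on S. g p * \<psi> p) = (LINT p|lebesgue_on T. g p * \<psi> p)"
      using S TL T C by (intro integral_lebesgue_on_cong_support) auto
    finally have "(LINT p|lebesgue_on T. g p * \<psi> p) = (e \<bullet> v) * (LINT p|lebesgue_on T. \<psi> p)"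
      using parts lint[OF int(1)] lint[OF int(2)] C by simp
    moreover have "integrable (lebesgue_on T) (\<lambda>p. g p * \<psi> p)"
      using locg TL cont(1) C by (intro integrable_locally_integrable_mult) auto
    moreover have "integrable (lebesgue_on T) \<psi>"
      using integrable_locally_integrable_mult[of T "\<lambda>p. 1" \<psi> C] TL cont(1) C
      by (auto simp: locally_integrable_def intro!: absolutely_integrable_on_const lmeasurable_compact)
    ultimately show "(LINT p|lebesgue_on T. (g p - e \<bullet> v) * \<psi> p) = 0"
      by (simp add: left_diff_distrib)
  qed
  then show ?thesis by simp
qed

section \<open>Integrals over the triangles of the grid\<close>

definition reference_triangle :: "(real \<times> real) set" where
  "reference_triangle = {p. 0 < snd p \<and> snd p < fst p \<and> fst p < 1}"

text \<open>
  The flag selects the triangle below or above the diagonal of the cell from \<open>(x i, y j)\<close> to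
  \<open>(x (i+1), y (j+1))\<close>. The diagonal is given by a cross product, which needs no division.
\<close>

fun open_triangle ::
  "(nat \<Rightarrow> real) \<Rightarrow> (nat \<Rightarrow> real) \<Rightarrow> nat \<times> nat \<times> bool \<Rightarrow> (real \<times> real) set" where
  "open_triangle x y (i, j, lower) = {p. x i < fst p \<and> fst p < x (i+1) \<and> y j < snd p \<and> snd p < y (j+1) \<and>
     (if lower then (snd p - y j) * (x (i+1) - x i) < (fst p - x i) * (y (j+1) - y j)
      else (fst p - x i) * (y (j+1) - y j) < (snd p - y j) * (x (i+1) - x i))}"

declare open_triangle.simps [simp del]

lemma open_open_triangle: "open (open_triangle x y \<tau>)"
proof -
  obtain i j lower where "\<tau> = (i, j, lower)" by (cases \<tau>)
  then show ?thesis
    by (cases lower) (simp add: open_triangle.simps, intro open_Collect_conj open_Collect_less continuous_intros)+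
qed

lemma open_triangle_subset_cbox:
  "open_triangle x y (i, j, lower) \<subseteq> cbox (x i, y j) (x (i+1), y (j+1))"
  by (auto simp: cbox_Pair_eq open_triangle.simps)

lemma integrable_indicator_mult_continuous:
  fixes f :: "'a::euclidean_space \<Rightarrow> real"
  assumes "T \<in> sets borel" "T \<subseteq> cbox a b" "continuous_on (cbox a b) f"
  shows "integrable lborel (\<lambda>p. indicator T p * f p)"
proof -
  have "integrable lborel (\<lambda>p. indicator (cbox a b) p *\<^sub>R f p)"
    using assms(3) by (intro borel_integrable_compact) auto
  then have "integrable lborel (\<lambda>p. indicator T p *\<^sub>R (indicator (cbox a b) p *\<^sub>R f p))"
    by (rule integrable_mult_indicator[rotated]) (simp add: assms(1))
  also have "(\<lambda>p. indicator T p *\<^sub>R (indicator (cbox a b) p *\<^sub>R f p)) = (\<lambda>p. indicator T p * f p)"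
    by (rule ext) (use assms(2) in \<open>auto simp: indicator_def dest: subsetD\<close>)
  finally show ?thesis .
qed

lemma integral_open_interval_FTC:
  fixes f F :: "real \<Rightarrow> real"
  assumes "a \<le> b" "\<And>s. (F has_real_derivative f s) (at s)" "\<And>s. isCont f s"
  shows "(LINT s|lborel. indicator {a<..<b} s * f s) = F b - F a"
proof -
  have [measurable]: "f \<in> borel_measurable borel"
    using assms(3) by (intro borel_measurable_continuous_onI) (simp add: continuous_at_imp_continuous_on)
  have "(LINT s|lborel. indicator {a<..<b} s * f s) = (LINT s|lborel. f s * indicator {a..b} s)"
  proof (rule integral_cong_AE)
    show "AE s in lborel. indicator {a<..<b} s * f s = f s * indicator {a..b} s"
      using AE_lborel_singleton[of a] AE_lborel_singleton[of b]
      by eventually_elim (auto simp: indicator_def)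
  qed measurable
  also have "\<dots> = F b - F a"
    using assms by (intro integral_FTC_Icc_real) auto
  finally show ?thesis .
qed

lemma integral_affine_reference_triangle:
  "(LINT p|lborel. indicator reference_triangle p * (a * fst p + b * snd p + c)) = a / 3 + b / 6 + c / 2"
proof -
  let ?f = "\<lambda>p. indicator reference_triangle p * (a * fst p + b * snd p + c)"
  have "open reference_triangle"
    unfolding reference_triangle_def by (intro open_Collect_conj open_Collect_less continuous_intros)
  then have [measurable]: "reference_triangle \<in> sets borel"
    by (rule borel_open)
  have "reference_triangle \<subseteq> cbox (0, 0) (1, 1)"
    by (auto simp: reference_triangle_def cbox_Pair_eq)
  then have "integrable lborel ?f"
    by (intro integrable_indicator_mult_continuous continuous_intros) measurable
  then have "(LINT p|lborel. ?f p) = (LINT s|lborel. LINT t|lborel. ?f (s, t))"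
    using lborel_pair.integral_fst'[of ?f] by (simp add: lborel_prod)
  also have "(\<lambda>s. LINT t|lborel. ?f (s, t)) =
      (\<lambda>s. indicator {0<..<1} s * ((a * s + c) * s + b * s\<^sup>2 / 2))"
  proof
    fix s :: real
    show "(LINT t|lborel. ?f (s, t)) = indicator {0<..<1} s * ((a * s + c) * s + b * s\<^sup>2 / 2)"
    proof (cases "0 < s \<and> s < 1")
      case True
      then have "(LINT t|lborel. ?f (s, t)) = (LINT t|lborel. indicator {0<..<s} t * (a * s + b * t + c))"
        by (intro Bochner_Integration.integral_cong) (auto simp: reference_triangle_def indicator_def)
      also have "\<dots> = ((a * s + c) * s + b * s\<^sup>2 / 2) - ((a * s + c) * 0 + b * 0\<^sup>2 / 2)"
        using True by (intro integral_open_interval_FTC)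
          (auto intro!: derivative_eq_intros continuous_intros)
      finally show ?thesis using True by simp
    next
      case False
      then have "(\<lambda>t. ?f (s, t)) = (\<lambda>t. 0)"
        by (auto simp: reference_triangle_def indicator_def)
      with False show ?thesis by (simp only: integral_zero) auto
    qed
  qed
  also have "(LINT s|lborel. indicator {0<..<1} s * ((a * s + c) * s + b * s\<^sup>2 / 2)) =
      (a * 1 ^ 3 / 3 + c * 1\<^sup>2 / 2 + b * 1 ^ 3 / 6) - (a * 0 ^ 3 / 3 + c * 0\<^sup>2 / 2 + b * 0 ^ 3 / 6)"
    by (intro integral_open_interval_FTC)
      (auto intro!: derivative_eq_intros continuous_intros simp: power2_eq_square algebra_simps)
  finally show ?thesis by simp
qed

lemma lborel_integral_axis_affine:
  fixes f :: "real \<times> real \<Rightarrow> real"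
  assumes [measurable]: "f \<in> borel_measurable borel" and "\<alpha> \<noteq> 0" "\<gamma> \<noteq> 0"
  shows "(LINT p|lborel. f p) = \<bar>\<alpha> * \<gamma>\<bar> * (LINT p|lborel. f (\<beta> + \<alpha> * fst p, \<delta> + \<gamma> * snd p))"
proof -
  \<comment> \<open>The scaling factors, indexed by the two basis vectors of the plane.\<close>
  define c where "c j = (if j = (1, 0) then \<alpha> else \<gamma>)" for j :: "real \<times> real"
  define A where "A p = (\<beta>, \<delta>) + (\<Sum>j\<in>Basis. (c j * (p \<bullet> j)) *\<^sub>R j)" for p :: "real \<times> real"
  have basis: "(Basis :: (real \<times> real) set) = {(1, 0), (0, 1)}"
    by (auto simp: Basis_prod_def)
  have A: "A p = (\<beta> + \<alpha> * fst p, \<delta> + \<gamma> * snd p)" for p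
    by (cases p) (simp add: A_def basis c_def)
  have prod: "(\<Prod>j\<in>Basis. \<bar>c j\<bar>) = \<bar>\<alpha> * \<gamma>\<bar>"
    by (simp add: basis c_def abs_mult)
  have "(lborel :: (real \<times> real) measure) = density (distr lborel borel A) (\<lambda>_. ennreal \<bar>\<alpha> * \<gamma>\<bar>)"
    using lborel_affine_euclidean[of c "(\<beta>, \<delta>)"] assms(2,3) unfolding prod A_def[abs_def]
    by (auto simp: c_def)
  moreover have [measurable]: "A \<in> borel_measurable borel"
    unfolding A by (intro borel_measurable_continuous_onI continuous_intros)
  ultimately have "(LINT p|lborel. f p) = (LINT p|density (distr lborel borel A) (\<lambda>_. ennreal \<bar>\<alpha> * \<gamma>\<bar>). f p)"
    by simp
  also have "\<dots> = \<bar>\<alpha> * \<gamma>\<bar> * (LINT p|lborel. f (A p))"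
    by (simp add: integral_density integral_distr)
  finally show ?thesis
    by (simp add: A)
qed

text \<open>
  Both triangles of a cell are images of the reference triangle under maps that scale the two axes
  separately: the lower one with positive factors, the upper one with negative factors, that is, after a
  point reflection of the cell. The integral is a third of the area times the sum of the three
  vertex values.
\<close>

lemma integral_affine_open_triangle:
  fixes a b c :: real
  assumes h: "x i < x (i+1)" "y j < y (j+1)"
  defines "l \<equiv> \<lambda>s t. a * s + b * t + c"
  shows "(LINT p|lborel. indicator (open_triangle x y (i, j, lower)) p * l (fst p) (snd p)) =
    (x (i+1) - x i) * (y (j+1) - y j) / 6 *
      (if lower then l (x i) (y j) + l (x (i+1)) (y j) + l (x (i+1)) (y (j+1))
       else l (x i) (y j) + l (x (i+1)) (y (j+1)) + l (x i) (y (j+1)))"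
proof -
  define hx hy where "hx = x (i+1) - x i" and "hy = y (j+1) - y j"
  have h': "0 < hx" "0 < hy"
    using h by (auto simp: hx_def hy_def)
  \<comment> \<open>The sign \<open>\<sigma>\<close> and the image \<open>(\<beta>, \<delta>)\<close> of the origin: the lower left or the upper right corner.\<close>
  define \<sigma> \<beta> \<delta> where "\<sigma> = (if lower then 1 else - 1 :: real)"
    and "\<beta> = (if lower then x i else x i + hx)" and "\<delta> = (if lower then y j else y j + hy)"
  let ?T = "open_triangle x y (i, j, lower)"
  have [measurable]: "?T \<in> sets borel"
    using open_open_triangle by (rule borel_open)
  have x': "x (i+1) = x i + hx" and y': "y (j+1) = y j + hy"
    by (simp_all add: hx_def hy_def)
  have lt: "hx * s < hx \<longleftrightarrow> s < 1" "hy * t < hy \<longleftrightarrow> t < 1" for s t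
    using h' mult_less_cancel_left_pos[of hx s 1] mult_less_cancel_left_pos[of hy t 1] by auto
  have diag: "t * (hx * hy) < s * (hx * hy) \<longleftrightarrow> t < s" for s t
    using h' by (intro mult_less_cancel_right_pos) simp
  have mem: "(\<beta> + \<sigma> * hx * s, \<delta> + \<sigma> * hy * t) \<in> ?T \<longleftrightarrow> (s, t) \<in> reference_triangle" for s t
  proof (cases lower)
    case True
    then have "(\<beta> + \<sigma> * hx * s, \<delta> + \<sigma> * hy * t) \<in> ?T \<longleftrightarrow>
        0 < s \<and> s < 1 \<and> 0 < t \<and> t < 1 \<and> t * (hx * hy) < s * (hx * hy)"
      unfolding open_triangle.simps x' y' using h' lt
      by (simp add: \<sigma>_def \<beta>_def \<delta>_def zero_less_mult_iff mult_ac)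
    then show ?thesis
      unfolding diag by (auto simp: reference_triangle_def)
  next
    case False
    then have pt: "\<beta> + \<sigma> * hx * s = x i + hx - hx * s" "\<delta> + \<sigma> * hy * t = y j + hy - hy * t"
      by (simp_all add: \<sigma>_def \<beta>_def \<delta>_def)
    have bounds: "x i < x i + hx - hx * s \<longleftrightarrow> s < 1" "y j < y j + hy - hy * t \<longleftrightarrow> t < 1"
      "x i + hx - hx * s < x i + hx \<longleftrightarrow> 0 < s" "y j + hy - hy * t < y j + hy \<longleftrightarrow> 0 < t"
      using h' lt(1)[of s] lt(2)[of t] by (simp_all add: zero_less_mult_iff)
    have "(x i + hx - hx * s - x i) * (y j + hy - y j) < (y j + hy - hy * t - y j) * (x i + hx - x i)
        \<longleftrightarrow> t * (hx * hy) < s * (hx * hy)"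
      by (simp add: algebra_simps)
    with False show ?thesis
      unfolding pt open_triangle.simps x' y' reference_triangle_def mem_Collect_eq fst_conv snd_conv
        bounds diag by auto
  qed
  have ind: "indicator ?T (\<beta> + \<sigma> * hx * fst p, \<delta> + \<sigma> * hy * snd p) = (indicator reference_triangle p :: real)"
    for p
    by (simp only: indicator_def mem prod.collapse)
  have "(LINT p|lborel. indicator ?T p * l (fst p) (snd p)) =
      \<bar>(\<sigma> * hx) * (\<sigma> * hy)\<bar> * (LINT p|lborel. indicator ?T (\<beta> + \<sigma> * hx * fst p, \<delta> + \<sigma> * hy * snd p) *
        l (\<beta> + \<sigma> * hx * fst p) (\<delta> + \<sigma> * hy * snd p))"
  proof (rule lborel_integral_axis_affine[where f = "\<lambda>p. indicator ?T p * l (fst p) (snd p)",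
        unfolded fst_conv snd_conv])
    show "(\<lambda>p. indicator ?T p * l (fst p) (snd p)) \<in> borel_measurable borel"
      unfolding l_def
      by (intro borel_measurable_times borel_measurable_indicator borel_measurable_continuous_onI
          continuous_intros) fact
  qed (use h' in \<open>simp_all add: \<sigma>_def\<close>)
  also have "\<bar>(\<sigma> * hx) * (\<sigma> * hy)\<bar> = hx * hy"
    using h' by (simp add: \<sigma>_def)
  also have "(\<lambda>p. indicator ?T (\<beta> + \<sigma> * hx * fst p, \<delta> + \<sigma> * hy * snd p) *
        l (\<beta> + \<sigma> * hx * fst p) (\<delta> + \<sigma> * hy * snd p)) =
      (\<lambda>p. indicator reference_triangle p * ((a * \<sigma> * hx) * fst p + (b * \<sigma> * hy) * snd p + l \<beta> \<delta>))"
    unfolding ind by (simp add: l_def algebra_simps)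
  also have "(LINT p|lborel. indicator reference_triangle p *
        ((a * \<sigma> * hx) * fst p + (b * \<sigma> * hy) * snd p + l \<beta> \<delta>)) =
      (a * \<sigma> * hx) / 3 + (b * \<sigma> * hy) / 6 + l \<beta> \<delta> / 2"
    by (rule integral_affine_reference_triangle)
  also have "\<dots> = (if lower then l (x i) (y j) + l (x (i+1)) (y j) + l (x (i+1)) (y (j+1))
       else l (x i) (y j) + l (x (i+1)) (y (j+1)) + l (x i) (y (j+1))) / 6"
    by (simp add: \<sigma>_def \<beta>_def \<delta>_def l_def hx_def hy_def field_simps)
  finally show ?thesis
    by (simp add: hx_def hy_def)
qed

section \<open>The grid\<close>

definition triangle_indices :: "nat \<Rightarrow> (nat \<times> nat \<times> bool) set" where
  "triangle_indices n = {1..<n} \<times> {1..<n} \<times> UNIV"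

lemma finite_triangle_indices: "finite (triangle_indices n)"
  by (simp add: triangle_indices_def)

lemma partition_less:
  "is_partition L n x \<Longrightarrow> i \<in> {1..n} \<Longrightarrow> j \<in> {1..n} \<Longrightarrow> i < j \<Longrightarrow> x i < x j"
  by (auto simp: is_partition_def strict_mono_on_def)

lemma partition_less_Suc:
  "is_partition L n x \<Longrightarrow> i \<in> {1..<n} \<Longrightarrow> x i < x (i+1)"
  by (rule partition_less[of L n x]) auto

lemma partition_bounds:
  assumes "is_partition L n x" "i \<in> {1..n}"
  shows "0 \<le> x i" "x i \<le> L"
  using assms partition_less[OF assms(1), of 1 i] partition_less[OF assms(1), of i n]
  by (cases "i = 1"; cases "i = n"; auto simp: is_partition_def)+

lemma partition_interval_unique:
  assumes P: "is_partition L n x" and "i \<in> {1..<n}" "j \<in> {1..<n}"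
    and s: "x i < s" "s < x (i+1)" "x j < s" "s < x (j+1)"
  shows "i = j"
proof (rule ccontr)
  assume "i \<noteq> j"
  then consider "i + 1 \<le> j" | "j + 1 \<le> i" by linarith
  then show False
  proof cases
    case 1
    then have "x (i+1) \<le> x j"
      using assms(2,3) partition_less[OF P, of "i+1" j] by (cases "i + 1 = j") auto
    with s show False by linarith
  next
    case 2
    then have "x (j+1) \<le> x i"
      using assms(2,3) partition_less[OF P, of "j+1" i] by (cases "j + 1 = i") auto
    with s show False by linarith
  qed
qed

lemma partition_interval_exists:
  assumes P: "is_partition L n x" and s: "0 < s" "s < L" "s \<notin> x ` {1..n}" and n: "2 \<le> n"
  shows "\<exists>i\<in>{1..<n}. x i < s \<and> s < x (i+1)"
proof -
  let ?A = "{i \<in> {1..n}. x i < s}"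
  define i where "i = Max ?A"
  have "1 \<in> ?A"
    using P s n by (auto simp: is_partition_def)
  then have i: "i \<in> ?A"
    unfolding i_def by (intro Max_in) auto
  moreover have "i \<noteq> n"
    using i P s by (auto simp: is_partition_def)
  ultimately have "i \<in> {1..<n}" by auto
  moreover have "\<not> x (i+1) < s"
  proof
    assume "x (i+1) < s"
    then have "i + 1 \<in> ?A" using \<open>i \<in> {1..<n}\<close> by auto
    then have "i + 1 \<le> i" unfolding i_def by (intro Max_ge) auto
    then show False by simp
  qed
  moreover have "x (i+1) \<noteq> s"
    using s(3) \<open>i \<in> {1..<n}\<close> by (auto intro: image_eqI)
  ultimately show ?thesis
    using i by force
qed

lemma open_triangle_subset_square:
  assumes P: "is_partition L n x" "is_partition L n y" and \<tau>: "\<tau> \<in> triangle_indices n"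
  shows "open_triangle x y \<tau> \<subseteq> square L"
proof -
  obtain i j l where \<tau>': "\<tau> = (i, j, l)" "i \<in> {1..<n}" "j \<in> {1..<n}"
    using \<tau> by (auto simp: triangle_indices_def)
  then show ?thesis
    using partition_bounds[OF P(1), of i] partition_bounds[OF P(1), of "i+1"]
      partition_bounds[OF P(2), of j] partition_bounds[OF P(2), of "j+1"]
    by (auto simp: square_def open_triangle.simps)
qed

lemma open_triangle_unique:
  assumes P: "is_partition L n x" "is_partition L n y"
    and "\<tau> \<in> triangle_indices n" "\<tau>' \<in> triangle_indices n"
    and "p \<in> open_triangle x y \<tau>" "p \<in> open_triangle x y \<tau>'"
  shows "\<tau> = \<tau>'"
proof -
  obtain i j l i' j' l' where \<tau>: "\<tau> = (i, j, l)" "\<tau>' = (i', j', l')"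
    "i \<in> {1..<n}" "j \<in> {1..<n}" "i' \<in> {1..<n}" "j' \<in> {1..<n}"
    using assms(3,4) by (auto simp: triangle_indices_def)
  then have "i = i'" "j = j'"
    using assms(5,6) partition_interval_unique[OF P(1), of i i' "fst p"]
      partition_interval_unique[OF P(2), of j j' "snd p"] by (auto simp: open_triangle.simps)
  with \<tau> assms(5,6) show ?thesis
    by (auto simp: open_triangle.simps split: if_splits)
qed

text \<open>
  What is missing lies on the grid lines and on the lines through the diagonals.
\<close>

lemma negligible_square_minus_triangles:
  assumes P: "is_partition L n x" "is_partition L n y" and n: "2 \<le> n"
  shows "negligible (square L - (\<Union>\<tau>\<in>triangle_indices n. open_triangle x y \<tau>))"
proof (rule negligible_subset)
  define v where "v = (\<lambda>(i, j). (y (j+1) - y j, - (x (i+1) - x i)))"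
  let ?lines = "(\<Union>i\<in>{1..n}. {p. (1, 0) \<bullet> p = x i}) \<union> (\<Union>j\<in>{1..n}. {p. (0, 1) \<bullet> p = y j}) \<union>
    (\<Union>(i, j)\<in>{1..<n}\<times>{1..<n}. {p. v (i, j) \<bullet> p = v (i, j) \<bullet> (x i, y j)})"
  have "v ij \<noteq> 0" if "ij \<in> {1..<n}\<times>{1..<n}" for ij
    using that partition_less_Suc[OF P(1), of "fst ij"] by (auto simp: v_def zero_prod_def)
  then show "negligible ?lines"
    by (intro negligible_Un negligible_Union)
      (auto intro!: negligible_hyperplane simp: zero_prod_def)
  show "square L - (\<Union>\<tau>\<in>triangle_indices n. open_triangle x y \<tau>) \<subseteq> ?lines"
  proof (rule subsetI, rule ccontr)
    fix p assume p: "p \<in> square L - (\<Union>\<tau>\<in>triangle_indices n. open_triangle x y \<tau>)" "p \<notin> ?lines"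
    obtain s t where st: "p = (s, t)" by (cases p)
    have "s \<notin> x ` {1..n}" "t \<notin> y ` {1..n}"
      using p(2) st by auto
    then obtain i j where ij: "i \<in> {1..<n}" "x i < s" "s < x (i+1)" "j \<in> {1..<n}" "y j < t" "t < y (j+1)"
      using partition_interval_exists[OF P(1) _ _ _ n, of s] partition_interval_exists[OF P(2) _ _ _ n, of t] p(1) st
      by (auto simp: square_def)
    have "v (i, j) \<bullet> p \<noteq> v (i, j) \<bullet> (x i, y j)"
      using p(2) ij(1,4) by blast
    then have "(s - x i) * (y (j+1) - y j) \<noteq> (t - y j) * (x (i+1) - x i)"
      by (simp add: v_def st algebra_simps)
    then have "\<exists>l. p \<in> open_triangle x y (i, j, l)"
      using ij st by (cases "(s - x i) * (y (j+1) - y j) < (t - y j) * (x (i+1) - x i)")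
        (auto simp: open_triangle.simps intro: exI[of _ False] exI[of _ True])
    then show False
      using p(1) ij(1,4) by (auto simp: triangle_indices_def)
  qed
qed

section \<open>Gradients of finite element functions\<close>

fun closed_triangle ::
  "(nat \<Rightarrow> real) \<Rightarrow> (nat \<Rightarrow> real) \<Rightarrow> nat \<times> nat \<times> bool \<Rightarrow> (real \<times> real) set" where
  "closed_triangle x y (i, j, lower) =
     convex hull {(x i, y j), (if lower then (x (i+1), y j) else (x i, y (j+1))), (x (i+1), y (j+1))}"

lemma closed_triangle_in_triangulation:
  "\<tau> \<in> triangle_indices n \<Longrightarrow> closed_triangle x y \<tau> \<in> triangulation n x y"
  by (force simp: triangle_indices_def triangulation_def)

lemma open_triangle_subset_closed_triangle: "open_triangle x y \<tau> \<subseteq> closed_triangle x y \<tau>"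
proof
  fix p assume p: "p \<in> open_triangle x y \<tau>"
  obtain i j l where \<tau>: "\<tau> = (i, j, l)" by (cases \<tau>)
  define hx hy where "hx = x (i+1) - x i" and "hy = y (j+1) - y j"
  have x': "x (i+1) = x i + hx" and y': "y (j+1) = y j + hy"
    by (simp_all add: hx_def hy_def)
  define s t where "s = (fst p - x i) / hx" and "t = (snd p - y j) / hy"
  have h: "0 < hx" "0 < hy"
    using p by (auto simp: hx_def hy_def \<tau> open_triangle.simps)
  have p': "p = (x i + hx * s, y j + hy * t)"
    using h by (simp add: s_def t_def)
  have st: "0 < s" "s < 1" "0 < t" "t < 1"
    using p h by (auto simp: s_def t_def \<tau> open_triangle.simps hx_def hy_def)
  have diag: "if l then t < s else s < t"
  proof -
    have "fst p - x i = hx * s" "snd p - y j = hy * t"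
      by (simp_all add: p')
    then have "if l then (hx * hy) * t < (hx * hy) * s else (hx * hy) * s < (hx * hy) * t"
      using p by (auto simp: \<tau> open_triangle.simps x'[simplified] y'[simplified] mult_ac split: if_splits)
    then show ?thesis
      using h by (simp add: mult_less_cancel_left_pos split: if_splits)
  qed
  show "p \<in> closed_triangle x y \<tau>"
  proof (cases l)
    case True
    have "p = (1 - s) *\<^sub>R (x i, y j) + (s - t) *\<^sub>R (x (i+1), y j) + t *\<^sub>R (x (i+1), y (j+1))"
      unfolding p' x' y' by (simp add: algebra_simps)
    moreover have "0 \<le> 1 - s" "0 \<le> s - t" "0 \<le> t" "(1 - s) + (s - t) + t = 1"
      using True diag st by auto
    ultimately show ?thesis
      unfolding \<tau> closed_triangle.simps convex_hull_3 if_P[OF True] by blast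
  next
    case False
    have "p = (1 - t) *\<^sub>R (x i, y j) + (t - s) *\<^sub>R (x i, y (j+1)) + s *\<^sub>R (x (i+1), y (j+1))"
      unfolding p' x' y' by (simp add: algebra_simps)
    moreover have "0 \<le> 1 - t" "0 \<le> t - s" "0 \<le> s" "(1 - t) + (t - s) + s = 1"
      using False diag st by auto
    ultimately show ?thesis
      unfolding \<tau> closed_triangle.simps convex_hull_3 if_not_P[OF False] by blast
  qed
qed

text \<open>
  The gradient of the affine interpolant on a triangle, read off from the vertex values along its
  horizontal and its vertical edge.
\<close>

fun slope ::
  "(nat \<Rightarrow> real) \<Rightarrow> (nat \<Rightarrow> real) \<Rightarrow> (real \<times> real \<Rightarrow> real) \<Rightarrow> nat \<times> nat \<times> bool \<Rightarrow> real \<times> real" where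
  "slope x y u (i, j, lower) =
    (if lower
     then ((u (x (i+1), y j) - u (x i, y j)) / (x (i+1) - x i),
           (u (x (i+1), y (j+1)) - u (x (i+1), y j)) / (y (j+1) - y j))
     else ((u (x (i+1), y (j+1)) - u (x i, y (j+1))) / (x (i+1) - x i),
           (u (x i, y (j+1)) - u (x i, y j)) / (y (j+1) - y j)))"

text \<open>
  On the edges, which form a null set, the value is \<open>0\<close>.
\<close>

definition pw_grad ::
  "nat \<Rightarrow> (nat \<Rightarrow> real) \<Rightarrow> (nat \<Rightarrow> real) \<Rightarrow> (real \<times> real \<Rightarrow> real) \<Rightarrow> real \<times> real \<Rightarrow> real \<times> real" where
  "pw_grad n x y u p = (\<Sum>\<tau>\<in>triangle_indices n. indicator (open_triangle x y \<tau>) p *\<^sub>R slope x y u \<tau>)"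

lemma pw_grad_eq_slope:
  assumes P: "is_partition L n x" "is_partition L n y"
    and \<tau>: "\<tau> \<in> triangle_indices n" "p \<in> open_triangle x y \<tau>"
  shows "pw_grad n x y u p = slope x y u \<tau>"
proof -
  have "pw_grad n x y u p = (\<Sum>\<sigma>\<in>triangle_indices n. if \<sigma> = \<tau> then slope x y u \<tau> else 0)"
    unfolding pw_grad_def
  proof (intro sum.cong refl)
    fix \<sigma> assume "\<sigma> \<in> triangle_indices n"
    then have "p \<in> open_triangle x y \<sigma> \<longleftrightarrow> \<sigma> = \<tau>"
      using open_triangle_unique[OF P _ \<tau>(1) _ \<tau>(2)] \<tau>(2) by blast
    then show "indicator (open_triangle x y \<sigma>) p *\<^sub>R slope x y u \<sigma> = (if \<sigma> = \<tau> then slope x y u \<tau> else 0)"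
      by (auto simp: indicator_def)
  qed
  then show ?thesis
    using \<tau>(1) finite_triangle_indices by simp
qed

text \<open>
  The vertices belong to the closed triangle, so the coefficients of the affine function are the
  difference quotients of its vertex values.
\<close>

lemma fe_space_affine:
  assumes P: "is_partition L n x" "is_partition L n y" and u: "u \<in> fe_space L n x y"
    and \<tau>: "\<tau> \<in> triangle_indices n"
  obtains c where "\<And>p. p \<in> closed_triangle x y \<tau> \<Longrightarrow> u p = p \<bullet> slope x y u \<tau> + c"
proof -
  obtain i j l where \<tau>': "\<tau> = (i, j, l)" "i \<in> {1..<n}" "j \<in> {1..<n}"
    using \<tau> by (auto simp: triangle_indices_def)
  have h: "x (i+1) - x i \<noteq> 0" "y (j+1) - y j \<noteq> 0"
    using partition_less_Suc[OF P(1) \<tau>'(2)] partition_less_Suc[OF P(2) \<tau>'(3)] by auto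
  from u closed_triangle_in_triangulation[OF \<tau>] obtain a b c where
    "\<forall>(s, t)\<in>closed_triangle x y \<tau>. u (s, t) = a * s + b * t + c"
    unfolding fe_space_def by blast
  then have abc: "u (s, t) = a * s + b * t + c" if "(s, t) \<in> closed_triangle x y \<tau>" for s t
    using that by auto
  have vertices: "(x i, y j) \<in> closed_triangle x y \<tau>" "(x (i+1), y (j+1)) \<in> closed_triangle x y \<tau>"
    "(if l then (x (i+1), y j) else (x i, y (j+1))) \<in> closed_triangle x y \<tau>"
    unfolding \<tau>' closed_triangle.simps by (auto intro!: hull_inc simp del: if_split)
  have "slope x y u \<tau> = (a, b)"
  proof (cases l)
    case True
    have "u (x (i+1), y j) - u (x i, y j) = a * (x (i+1) - x i)"
      "u (x (i+1), y (j+1)) - u (x (i+1), y j) = b * (y (j+1) - y j)"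
      using vertices True by (simp_all add: abc right_diff_distrib)
    then show ?thesis using True h by (simp add: \<tau>'(1))
  next
    case False
    have "u (x (i+1), y (j+1)) - u (x i, y (j+1)) = a * (x (i+1) - x i)"
      "u (x i, y (j+1)) - u (x i, y j) = b * (y (j+1) - y j)"
      using vertices False by (simp_all add: abc right_diff_distrib)
    then show ?thesis using False h by (simp add: \<tau>'(1))
  qed
  then show thesis
    using abc by (intro that[of c]) (auto simp: mult.commute)
qed

declare slope.simps [simp del] closed_triangle.simps [simp del]

lemma square_lmeasurable: "square L \<in> lmeasurable"
  unfolding square_def by (intro lmeasurable_open bounded_Times open_Times) auto

lemma square_sets_lebesgue: "square L \<in> sets lebesgue"
  using square_lmeasurable by (rule fmeasurableD)

lemma AE_squareI_triangles:
  assumes P: "is_partition L n x" "is_partition L n y" and n: "2 \<le> n"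
    and *: "\<And>\<tau>. \<tau> \<in> triangle_indices n \<Longrightarrow> negligible {p \<in> open_triangle x y \<tau>. \<not> Q p}"
  shows "AE p in lebesgue_on (square L). Q p"
proof -
  let ?N = "(\<Union>\<tau>\<in>triangle_indices n. {p \<in> open_triangle x y \<tau>. \<not> Q p}) \<union>
    (square L - (\<Union>\<tau>\<in>triangle_indices n. open_triangle x y \<tau>))"
  have "negligible ?N"
    using * negligible_square_minus_triangles[OF P n] finite_triangle_indices
    by (intro negligible_Un negligible_Union) auto
  then have "AE p in lebesgue. p \<notin> ?N"
    unfolding negligible_iff_null_sets by (rule AE_not_in)
  then have "AE p in lebesgue. p \<in> square L \<longrightarrow> Q p"
    by eventually_elim auto
  then show ?thesis
    using square_sets_lebesgue by (simp add: AE_restrict_space_iff)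
qed

text \<open>
  This turns the weak derivatives in the matrices, which are known only through their defining
  property, into explicit piecewise constant functions.
\<close>

lemma weak_deriv_fe_space_AE:
  assumes P: "is_partition L n x" "is_partition L n y" and n: "2 \<le> n"
    and u: "u \<in> fe_space L n x y" and e: "e \<in> Basis" and weak: "is_weak_deriv (square L) e u g"
  shows "AE p in lebesgue_on (square L). weak_deriv (square L) e u p = e \<bullet> pw_grad n x y u p"
proof (rule AE_squareI_triangles[OF P n])
  fix \<tau> assume \<tau>: "\<tau> \<in> triangle_indices n"
  obtain c where c: "\<And>p. p \<in> closed_triangle x y \<tau> \<Longrightarrow> u p = p \<bullet> slope x y u \<tau> + c"
    using fe_space_affine[OF P u \<tau>] by blast
  have "negligible {p \<in> open_triangle x y \<tau>. weak_deriv (square L) e u p \<noteq> e \<bullet> slope x y u \<tau>}"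
    using square_sets_lebesgue open_open_triangle open_triangle_subset_square[OF P \<tau>] e is_weak_deriv_weak_deriv[OF weak]
      c[OF subsetD[OF open_triangle_subset_closed_triangle]]
    by (rule is_weak_deriv_affine_piece)
  then show "negligible {p \<in> open_triangle x y \<tau>. weak_deriv (square L) e u p \<noteq> e \<bullet> pw_grad n x y u p}"
    by (rule negligible_subset) (auto simp: pw_grad_eq_slope[OF P \<tau>])
qed

lemma integral_square_eq_sum_triangles:
  fixes f :: "real \<times> real \<Rightarrow> real" and g :: "nat \<times> nat \<times> bool \<Rightarrow> real \<times> real \<Rightarrow> real"
  assumes P: "is_partition L n x" "is_partition L n y" and n: "2 \<le> n"
    and f: "\<And>\<tau> p. \<tau> \<in> triangle_indices n \<Longrightarrow> p \<in> open_triangle x y \<tau> \<Longrightarrow> f p = g \<tau> p"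
    and g: "\<And>\<tau>. \<tau> \<in> triangle_indices n \<Longrightarrow> integrable lborel (\<lambda>p. indicator (open_triangle x y \<tau>) p * g \<tau> p)"
    and meas: "f \<in> borel_measurable (lebesgue_on (square L))"
  shows "(LINT p|lebesgue_on (square L). f p) =
    (\<Sum>\<tau>\<in>triangle_indices n. LINT p|lborel. indicator (open_triangle x y \<tau>) p * g \<tau> p)"
proof -
  let ?g = "\<lambda>p. \<Sum>\<tau>\<in>triangle_indices n. indicator (open_triangle x y \<tau>) p * g \<tau> p"
  have int: "integrable lborel ?g"
    using g by simp
  have g_eq: "?g p = g \<tau> p" if \<tau>: "\<tau> \<in> triangle_indices n" "p \<in> open_triangle x y \<tau>" for \<tau> p
  proof -
    have "?g p = (\<Sum>\<sigma>\<in>triangle_indices n. if \<sigma> = \<tau> then g \<tau> p else 0)"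
    proof (intro sum.cong refl)
      fix \<sigma> assume "\<sigma> \<in> triangle_indices n"
      then have "p \<in> open_triangle x y \<sigma> \<longleftrightarrow> \<sigma> = \<tau>"
        using open_triangle_unique[OF P _ \<tau>(1) _ \<tau>(2)] \<tau>(2) by blast
      then show "indicator (open_triangle x y \<sigma>) p * g \<sigma> p = (if \<sigma> = \<tau> then g \<tau> p else 0)"
        by (auto simp: indicator_def)
    qed
    then show ?thesis
      using \<tau>(1) finite_triangle_indices by simp
  qed
  have "?g \<in> borel_measurable lebesgue"
    using borel_measurable_integrable[OF int] by (rule measurable_completion)
  then have "?g \<in> borel_measurable (lebesgue_on (square L))"
    by (rule measurable_restrict_space1)
  moreover have "AE p in lebesgue_on (square L). f p = ?g p"
  proof (rule AE_squareI_triangles[OF P n])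
    show "negligible {p \<in> open_triangle x y \<tau>. f p \<noteq> ?g p}" if \<tau>: "\<tau> \<in> triangle_indices n" for \<tau>
    proof -
      have "{p \<in> open_triangle x y \<tau>. f p \<noteq> ?g p} = {}"
        using f[OF \<tau>] g_eq[OF \<tau>] by auto
      then show ?thesis by (simp only: negligible_empty)
    qed
  qed
  ultimately have "(LINT p|lebesgue_on (square L). f p) = (LINT p|lebesgue_on (square L). ?g p)"
    using meas by (intro integral_cong_AE)
  also have "\<dots> = (LINT p|lebesgue_on UNIV. ?g p)"
  proof (rule integral_lebesgue_on_cong_support[symmetric])
    fix p assume "p \<in> UNIV - square L"
    then have "p \<notin> open_triangle x y \<tau>" if "\<tau> \<in> triangle_indices n" for \<tau>
      using open_triangle_subset_square[OF P that] by blast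
    then show "?g p = 0"
      by (intro sum.neutral) simp
  qed (use square_sets_lebesgue in auto)
  also have "\<dots> = (LINT p|lborel. ?g p)"
    using borel_measurable_integrable[OF int] by (simp add: lebesgue_on_UNIV_eq integral_completion)
  also have "\<dots> = (\<Sum>\<tau>\<in>triangle_indices n. LINT p|lborel. indicator (open_triangle x y \<tau>) p * g \<tau> p)"
    using g by (rule Bochner_Integration.integral_sum)
  finally show ?thesis .
qed

text \<open>
  Completeness of Lebesgue measure transfers measurability from \<open>g\<close> to \<open>f\<close>. Here \<open>f\<close> will involve
  arbitrary representatives of weak derivatives.
\<close>

lemma integral_lebesgue_on_cong_AE:
  fixes f g :: "'a::euclidean_space \<Rightarrow> real"
  assumes S: "S \<in> sets lebesgue" and g: "g \<in> borel_measurable (lebesgue_on S)"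
    and eq: "AE p in lebesgue_on S. f p = g p"
  shows "(LINT p|lebesgue_on S. f p) = (LINT p|lebesgue_on S. g p)"
proof -
  have "(\<lambda>p. indicator S p *\<^sub>R g p) \<in> borel_measurable lebesgue"
    using g S by (simp add: borel_measurable_restrict_space_iff)
  moreover have ae: "AE p in lebesgue. indicator S p *\<^sub>R g p = indicator S p *\<^sub>R f p"
    using eq S by (auto simp: AE_restrict_space_iff elim!: eventually_mono)
  ultimately have "(\<lambda>p. indicator S p *\<^sub>R f p) \<in> borel_measurable lebesgue"
    by (rule borel_measurable_AE)
  then have "f \<in> borel_measurable (lebesgue_on S)"
    using S by (simp add: borel_measurable_restrict_space_iff)
  then show ?thesis
    using g eq by (rule integral_cong_AE)
qed

section \<open>Cancellation over the triangles\<close>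

text \<open>
  The contribution of an edge, traversed from a vertex with values \<open>u\<close>, \<open>w\<close> to a vertex with values
  \<open>u'\<close>, \<open>w'\<close>, to six times the integral of \<open>(u\<^sub>x w\<^sub>y - u\<^sub>y w\<^sub>x) w\<close> over an adjacent triangle.
\<close>

definition edge_term :: "real \<Rightarrow> real \<Rightarrow> real \<Rightarrow> real \<Rightarrow> real" where
  "edge_term u w u' w' = (u - u') * w * w' + u * w'\<^sup>2 - u' * w\<^sup>2"

lemma edge_term_antisym: "edge_term u' w' u w = - edge_term u w u' w'"
  by (simp add: edge_term_def algebra_simps power2_eq_square)

text \<open>
  The left-hand side is the Jacobian determinant of \<open>(u, w)\<close> times twice the area, times the sum of the
  vertex values of \<open>w\<close>. The products of values at three different vertices cancel, which is why the result
  splits into contributions of single edges.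
\<close>

lemma triangle_edge_terms:
  "((u2 - u1) * (w3 - w2) - (u3 - u2) * (w2 - w1)) * (w1 + w2 + w3) =
     edge_term u1 w1 u2 w2 + edge_term u2 w2 u3 w3 + edge_term u3 w3 u1 w1"
  by (simp add: edge_term_def algebra_simps power2_eq_square)

lemma sum_periodic_differences_eq_0:
  fixes f :: "nat \<Rightarrow> 'a::ab_group_add"
  assumes "1 \<le> n" "f n = f 1"
  shows "(\<Sum>i\<in>{1..<n}. f (i + 1) - f i) = 0"
  using sum_Suc_diff'[of 1 n f] assms by simp

text \<open>
  In each cell the two triangles traverse the diagonal in opposite directions, and the edges that remain
  are differences between neighbouring parallel edges. These telescope across the grid, and
  periodicity identifies the two ends.
\<close>

lemma sum_grid_edge_terms_eq_0:
  fixes u w :: "nat \<Rightarrow> nat \<Rightarrow> real"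
  assumes n: "1 \<le> n"
    and per: "\<And>i. i \<in> {1..n} \<Longrightarrow> u i n = u i 1" "\<And>i. i \<in> {1..n} \<Longrightarrow> w i n = w i 1"
      "\<And>j. j \<in> {1..n} \<Longrightarrow> u n j = u 1 j" "\<And>j. j \<in> {1..n} \<Longrightarrow> w n j = w 1 j"
  defines "E \<equiv> \<lambda>i j i' j'. edge_term (u i j) (w i j) (u i' j') (w i' j')"
  shows "(\<Sum>i\<in>{1..<n}. \<Sum>j\<in>{1..<n}.
      (E i j (i+1) j + E (i+1) j (i+1) (j+1) + E (i+1) (j+1) i j) +
      (E i j (i+1) (j+1) + E (i+1) (j+1) i (j+1) + E i (j+1) i j)) = 0"
proof -
  have anti: "E i' j' i j = - E i j i' j'" for i j i' j'
    unfolding E_def by (rule edge_term_antisym)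
  have "(\<Sum>i\<in>{1..<n}. \<Sum>j\<in>{1..<n}.
      (E i j (i+1) j + E (i+1) j (i+1) (j+1) + E (i+1) (j+1) i j) +
      (E i j (i+1) (j+1) + E (i+1) (j+1) i (j+1) + E i (j+1) i j))
    = (\<Sum>i\<in>{1..<n}. \<Sum>j\<in>{1..<n}.
        (E (i+1) j (i+1) (j+1) - E i j i (j+1)) - (E i (j+1) (i+1) (j+1) - E i j (i+1) j))"
  proof (intro sum.cong refl)
    fix i j
    show "(E i j (i+1) j + E (i+1) j (i+1) (j+1) + E (i+1) (j+1) i j) +
        (E i j (i+1) (j+1) + E (i+1) (j+1) i (j+1) + E i (j+1) i j)
      = (E (i+1) j (i+1) (j+1) - E i j i (j+1)) - (E i (j+1) (i+1) (j+1) - E i j (i+1) j)"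
      using anti[of "i+1" "j+1" i j] anti[of "i+1" "j+1" i "j+1"] anti[of i "j+1" i j] by linarith
  qed
  also have "\<dots> = (\<Sum>j\<in>{1..<n}. \<Sum>i\<in>{1..<n}. E (i+1) j (i+1) (j+1) - E i j i (j+1))
      - (\<Sum>i\<in>{1..<n}. \<Sum>j\<in>{1..<n}. E i (j+1) (i+1) (j+1) - E i j (i+1) j)"
    by (subst sum.swap) (simp add: sum_subtractf)
  also have "(\<Sum>i\<in>{1..<n}. E (i+1) j (i+1) (j+1) - E i j i (j+1)) = 0" if "j \<in> {1..<n}" for j
    using n that per
    by (intro sum_periodic_differences_eq_0[where f = "\<lambda>i. E i j i (j+1)"]) (auto simp: E_def)
  then have "(\<Sum>j\<in>{1..<n}. \<Sum>i\<in>{1..<n}. E (i+1) j (i+1) (j+1) - E i j i (j+1)) = 0"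
    by (intro sum.neutral) auto
  also have "(\<Sum>j\<in>{1..<n}. E i (j+1) (i+1) (j+1) - E i j (i+1) j) = 0" if "i \<in> {1..<n}" for i
    using n that per
    by (intro sum_periodic_differences_eq_0[where f = "\<lambda>j. E i j (i+1) j"]) (auto simp: E_def)
  then have "(\<Sum>i\<in>{1..<n}. \<Sum>j\<in>{1..<n}. E i (j+1) (i+1) (j+1) - E i j (i+1) j) = 0"
    by (intro sum.neutral) auto
  finally show ?thesis by simp
qed

section \<open>The nonlinear system\<close>

text \<open>
  If \<open>F\<close> had no zero, \<open>y \<mapsto> - r F y / \<parallel>F y\<parallel>\<close> would map the ball continuously into its
  boundary sphere. At a fixed point, supplied by Brouwer's theorem, \<open>F y\<close> would be a negative multiple of
  \<open>y\<close>.
\<close>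

lemma exists_zero_if_outward_on_sphere:
  fixes F :: "'a::euclidean_space \<Rightarrow> 'a"
  assumes r: "0 < r" and cont: "continuous_on (cball 0 r) F"
    and out: "\<And>y. norm y = r \<Longrightarrow> 0 < y \<bullet> F y"
  shows "\<exists>y. F y = 0"
proof (rule ccontr)
  assume "\<nexists>y. F y = 0"
  then have nz: "F y \<noteq> 0" for y by blast
  define g where "g y = - (r / norm (F y)) *\<^sub>R F y" for y
  have norm_g: "norm (g y) = r" for y
    using r nz[of y] by (simp add: g_def)
  have "continuous_on (cball 0 r) g"
    unfolding g_def using nz by (intro continuous_intros cont) auto
  moreover have "g \<in> cball 0 r \<rightarrow> cball 0 r"
    using norm_g by simp
  ultimately obtain y where y: "g y = y"
    using brouwer_ball[OF r] by blast
  then have "y \<bullet> y = - (r / norm (F y)) * (y \<bullet> F y)"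
    by (metis g_def inner_scaleR_right)
  moreover have "0 < y \<bullet> F y"
    using norm_g[of y] y out by simp
  moreover have "0 < r / norm (F y)"
    using r nz[of y] by simp
  ultimately have "y \<bullet> y < 0"
    by (metis minus_mult_left mult_pos_pos neg_less_0_iff_less)
  then show False
    using inner_ge_zero[of y] by linarith
qed

text \<open>
  The constant is the minimum of the quadratic form on the unit sphere.
\<close>

lemma positive_definite_coercive:
  fixes M :: "real ^ 'm ^ 'm"
  assumes pos: "\<And>Y. Y \<noteq> 0 \<Longrightarrow> 0 < Y \<bullet> (M *v Y)"
  obtains c where "0 < c" "\<And>Y. c * (norm Y)\<^sup>2 \<le> Y \<bullet> (M *v Y)"
proof -
  obtain Y0 where Y0: "Y0 \<in> sphere 0 1"
    and min: "\<And>Y. Y \<in> sphere 0 1 \<Longrightarrow> Y0 \<bullet> (M *v Y0) \<le> Y \<bullet> (M *v Y)"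
  proof -
    have "sphere (0 :: real ^ 'm) 1 \<noteq> {}" by simp
    moreover have "continuous_on (sphere 0 1) (\<lambda>Y. Y \<bullet> (M *v Y))"
      by (intro continuous_intros matrix_vector_mult_linear_continuous_on)
    ultimately show ?thesis
      using continuous_attains_inf[OF compact_sphere] that by blast
  qed
  show thesis
  proof
    show "0 < Y0 \<bullet> (M *v Y0)"
      using Y0 by (intro pos) auto
    show "Y0 \<bullet> (M *v Y0) * (norm Y)\<^sup>2 \<le> Y \<bullet> (M *v Y)" for Y
    proof (cases "Y = 0")
      case False
      have "Y0 \<bullet> (M *v Y0) \<le> (Y /\<^sub>R norm Y) \<bullet> (M *v (Y /\<^sub>R norm Y))"
        using False by (intro min) simp
      also have "\<dots> = Y \<bullet> (M *v Y) / (norm Y)\<^sup>2"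
        by (simp add: matrix_vector_mult_scaleR power2_eq_square divide_inverse)
      finally show ?thesis
        using False by (simp add: field_simps)
    qed simp
  qed
qed

lemma invertible_if_positive_definite:
  fixes A :: "real ^ 'm ^ 'm"
  assumes "\<And>Y. Y \<noteq> 0 \<Longrightarrow> 0 < Y \<bullet> (A *v Y)"
  shows "invertible A"
proof -
  have "\<forall>Y. A *v Y = 0 \<longrightarrow> Y = 0"
    using assms by (metis inner_zero_right less_irrefl)
  then obtain A' where "A' ** A = mat 1"
    using matrix_left_invertible_ker[of A] by blast
  then show ?thesis
    using matrix_left_right_inverse[of A' A] by (auto simp: invertible_def)
qed

lemma matrix_inv_mult_vec:
  fixes A :: "real ^ 'm ^ 'm"
  assumes "invertible A"
  shows "A *v (matrix_inv A *v Y) = Y" "matrix_inv A *v (A *v Y) = Y"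
proof -
  have "A ** matrix_inv A = mat 1 \<and> matrix_inv A ** A = mat 1"
    using assms unfolding invertible_def matrix_inv_def by (rule someI_ex)
  then show "A *v (matrix_inv A *v Y) = Y" "matrix_inv A *v (A *v Y) = Y"
    by (simp_all add: matrix_vector_mul_assoc)
qed

text \<open>
  The finite-dimensional core of the argument. In the application, \<open>q U\<close> is the squared norm of the
  \<open>y\<close>-derivative of the function with coefficients \<open>U\<close>; \<open>M_young\<close> and \<open>R_young\<close> are
  Young's inequality under the integral sign. For
  \<open>U = K\<^sup>-\<^sup>1 M Y\<close> they give \<open>q U \<le> m / 4\<close> with \<open>m = Y \<bullet> M Y\<close>, so the perturbation of \<open>M\<close> in \<open>B\<close> costs at most \<open>(m / 4 + m) / 4 \<le> m / 2\<close>.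
\<close>

lemma abstract_scheme_solvable:
  fixes M K R :: "real ^ 'm ^ 'm" and S :: "real ^ 'm \<Rightarrow> real ^ 'm ^ 'm" and q :: "real ^ 'm \<Rightarrow> real"
  assumes M_pos: "\<And>Y. Y \<noteq> 0 \<Longrightarrow> 0 < Y \<bullet> (M *v Y)"
    and M_young: "\<And>U Y. U \<bullet> (M *v Y) \<le> U \<bullet> (M *v U) + (Y \<bullet> (M *v Y)) / 4"
    and q_nonneg: "\<And>U. 0 \<le> q U"
    and K_ge: "\<And>U. U \<bullet> (M *v U) + q U \<le> U \<bullet> (K *v U)"
    and R_young: "\<And>U Y. \<bar>Y \<bullet> (R *v U)\<bar> \<le> \<bar>k\<bar> / 2 * (q U + Y \<bullet> (M *v Y))"
    and S_skew: "\<And>U Y. Y \<bullet> (S U *v Y) = 0"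
    and S_cont: "continuous_on UNIV S"
    and \<tau>: "0 < \<tau>" "k \<noteq> 0 \<longrightarrow> \<tau> \<le> 1 / (2 * \<bar>k\<bar>)"
  defines "B \<equiv> M - \<tau> *\<^sub>R (R ** matrix_inv K ** M)"
  shows "\<exists>Y. Y = matrix_inv B *v (M *v Z - \<tau> *\<^sub>R (S (matrix_inv K *v (M *v Y)) *v Y))"
proof -
  define U where "U Y = matrix_inv K *v (M *v Y)" for Y
  have "invertible K"
  proof (rule invertible_if_positive_definite)
    show "0 < V \<bullet> (K *v V)" if "V \<noteq> 0" for V
      using M_pos[OF that] K_ge[of V] q_nonneg[of V] by linarith
  qed
  then have KU: "K *v U Y = M *v Y" for Y
    by (simp add: U_def matrix_inv_mult_vec)
  have B_eq: "B *v Y = M *v Y - \<tau> *\<^sub>R (R *v U Y)" for Y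
    by (simp add: B_def U_def matrix_vector_mult_diff_rdistrib
        flip: matrix_vector_mul_assoc scaleR_matrix_vector_assoc)
  have k\<tau>: "\<tau> * \<bar>k\<bar> \<le> 1 / 2"
    using \<tau> by (cases "k = 0") (auto simp: field_simps)
  have B_ge: "Y \<bullet> (M *v Y) / 2 \<le> Y \<bullet> (B *v Y)" for Y
  proof -
    let ?m = "Y \<bullet> (M *v Y)"
    have m: "0 \<le> ?m"
      using M_pos[of Y] by (cases "Y = 0") auto
    have q: "q (U Y) \<le> ?m / 4"
      using K_ge[of "U Y"] M_young[of "U Y" Y] by (simp add: KU)
    have "\<tau> * (Y \<bullet> (R *v U Y)) \<le> \<tau> * (\<bar>k\<bar> / 2 * (q (U Y) + ?m))"
      using R_young[of Y "U Y"] \<tau>(1) by (intro mult_left_mono) auto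
    also have "\<dots> = \<tau> * \<bar>k\<bar> * ((q (U Y) + ?m) / 2)"
      by simp
    also have "\<dots> \<le> 1 / 2 * ((q (U Y) + ?m) / 2)"
      using k\<tau> m q_nonneg[of "U Y"] by (intro mult_right_mono) auto
    also have "\<dots> \<le> ?m / 2"
      using q m by simp
    finally show ?thesis
      by (simp add: B_eq inner_diff_right)
  qed
  have "invertible B"
  proof (rule invertible_if_positive_definite)
    show "0 < Y \<bullet> (B *v Y)" if "Y \<noteq> 0" for Y
      using M_pos[OF that] B_ge[of Y] by linarith
  qed
  define F where "F Y = B *v Y + \<tau> *\<^sub>R (S (U Y) *v Y) - M *v Z" for Y
  obtain c where c: "0 < c" "\<And>Y. c * (norm Y)\<^sup>2 \<le> Y \<bullet> (M *v Y)"
    using positive_definite_coercive[OF M_pos] by blast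
  \<comment> \<open>Beyond this radius the quadratic term \<open>c r\<^sup>2 / 2\<close> exceeds the linear term \<open>\<parallel>M Z\<parallel> r\<close>.\<close>
  define r where "r = 2 * norm (M *v Z) / c + 1"
  have r: "0 < r"
    using c(1) by (simp add: r_def add_nonneg_pos)
  have "\<exists>Y. F Y = 0"
  proof (rule exists_zero_if_outward_on_sphere[OF r])
    have "continuous_on UNIV U"
      unfolding U_def matrix_vector_mul_assoc by (rule matrix_vector_mult_linear_continuous_on)
    then have "continuous_on UNIV (\<lambda>Y. S (U Y))"
      using continuous_on_compose2[OF S_cont] by blast
    then have "continuous_on UNIV (\<lambda>Y. S (U Y) *v Y)"
      unfolding matrix_vector_mult_def by (intro continuous_intros)
    then have "continuous_on UNIV F"
      unfolding F_def by (intro continuous_intros matrix_vector_mult_linear_continuous_on)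
    then show "continuous_on (cball 0 r) F"
      by (rule continuous_on_subset) simp
    show "0 < Y \<bullet> F Y" if "norm Y = r" for Y
    proof -
      have "c * r = 2 * norm (M *v Z) + c"
        using c(1) by (simp add: r_def field_simps)
      then have "c * r\<^sup>2 / 2 = norm (M *v Z) * r + c * r / 2"
        by (simp add: power2_eq_square field_simps) algebra
      then have "norm (M *v Z) * r < c * r\<^sup>2 / 2"
        using r c(1) by simp
      moreover have "Y \<bullet> (M *v Z) \<le> norm (M *v Z) * r"
        using norm_cauchy_schwarz[of Y "M *v Z"] that by (simp add: mult.commute)
      moreover have "c * r\<^sup>2 / 2 \<le> Y \<bullet> (B *v Y)"
        using c(2)[of Y] B_ge[of Y] that by simp
      ultimately show ?thesis
        by (simp add: F_def inner_diff_right inner_add_right S_skew)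
    qed
  qed
  then obtain Y where "B *v Y = M *v Z - \<tau> *\<^sub>R (S (U Y) *v Y)"
    by (auto simp: F_def algebra_simps)
  then have "Y = matrix_inv B *v (M *v Z - \<tau> *\<^sub>R (S (U Y) *v Y))"
    using matrix_inv_mult_vec(2)[OF \<open>invertible B\<close>, of Y] by simp
  then show ?thesis
    unfolding U_def by blast
qed

section \<open>Bounded measurable functions\<close>

text \<open>
  On a set of finite measure these functions are integrable, and unlike the integrable functions they
  are closed under products. All integrands in the matrices are of this kind.
\<close>

definition bounded_measurable :: "'a::euclidean_space set \<Rightarrow> ('a \<Rightarrow> real) \<Rightarrow> bool" where
  "bounded_measurable S f \<longleftrightarrow> f \<in> borel_measurable (lebesgue_on S) \<and> (\<exists>B. \<forall>p\<in>S. \<bar>f p\<bar> \<le> B)"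

lemma bounded_measurable_const: "bounded_measurable S (\<lambda>p. c)"
  by (auto simp: bounded_measurable_def)

lemma bounded_measurable_add:
  assumes "bounded_measurable S f" "bounded_measurable S g"
  shows "bounded_measurable S (\<lambda>p. f p + g p)"
proof -
  obtain A B where "\<forall>p\<in>S. \<bar>f p\<bar> \<le> A" "\<forall>p\<in>S. \<bar>g p\<bar> \<le> B"
    using assms by (auto simp: bounded_measurable_def)
  then have "\<forall>p\<in>S. \<bar>f p + g p\<bar> \<le> A + B"
    by (meson abs_triangle_ineq add_mono order_trans)
  then show ?thesis
    using assms by (auto simp: bounded_measurable_def)
qed

lemma bounded_measurable_mult:
  assumes "bounded_measurable S f" "bounded_measurable S g"
  shows "bounded_measurable S (\<lambda>p. f p * g p)"
proof -
  obtain A B where AB: "\<forall>p\<in>S. \<bar>f p\<bar> \<le> A" "\<forall>p\<in>S. \<bar>g p\<bar> \<le> B"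
    using assms by (auto simp: bounded_measurable_def)
  have "\<bar>f p * g p\<bar> \<le> A * B" if "p \<in> S" for p
    unfolding abs_mult using AB that by (intro mult_mono) (auto intro: order_trans[OF abs_ge_zero])
  then show ?thesis
    using assms by (auto simp: bounded_measurable_def)
qed

lemma bounded_measurable_sum:
  assumes "finite I" "\<And>i. i \<in> I \<Longrightarrow> bounded_measurable S (f i)"
  shows "bounded_measurable S (\<lambda>p. \<Sum>i\<in>I. f i p)"
  using assms
  by (induction I rule: finite_induct) (auto simp: bounded_measurable_const bounded_measurable_add)

lemma bounded_measurable_indicator:
  assumes "open T"
  shows "bounded_measurable S (indicator T)"
proof -
  have "(indicator T :: _ \<Rightarrow> real) \<in> borel_measurable (lebesgue_on S)"
    using assms by (intro measurable_restrict_space1 borel_measurable_indicator) auto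
  then show ?thesis
    by (auto simp: bounded_measurable_def indicator_def intro!: exI[of _ 1])
qed

lemma bounded_measurable_continuous:
  assumes "continuous_on C f" "compact C" "S \<subseteq> C" "S \<in> sets lebesgue"
  shows "bounded_measurable S f"
proof -
  have "bounded (f ` C)"
    using assms by (intro compact_imp_bounded compact_continuous_image)
  then obtain B where "\<forall>p\<in>C. \<bar>f p\<bar> \<le> B"
    by (auto simp: bounded_iff)
  moreover have "f \<in> borel_measurable (lebesgue_on S)"
    using assms by (intro continuous_imp_measurable_on_sets_lebesgue continuous_on_subset[OF assms(1)])
  ultimately show ?thesis
    using assms(3) by (auto simp: bounded_measurable_def)
qed

lemma bounded_measurable_integrable:
  assumes "S \<in> lmeasurable" "bounded_measurable S f"
  shows "integrable (lebesgue_on S) f"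
proof -
  interpret finite_measure "lebesgue_on S"
    using assms(1) by (rule finite_measure_lebesgue_on)
  obtain B where "\<forall>p\<in>S. \<bar>f p\<bar> \<le> B"
    using assms(2) by (auto simp: bounded_measurable_def)
  then show ?thesis
    using assms(2) by (intro integrable_const_bound[of _ B]) (auto simp: bounded_measurable_def)
qed

text \<open>
  The vector \<open>V\<close> goes with the column index \<open>I\<close>, hence with the trial function, and \<open>W\<close> with the row
  index \<open>J\<close> of the test function.
\<close>

lemma quadratic_form_eq_integral:
  fixes f g :: "'m::finite \<Rightarrow> 'a \<Rightarrow> real" and A :: "real ^ 'm ^ 'm"
  assumes int: "\<And>I J. integrable \<mu> (\<lambda>p. f I p * g J p)"
    and A: "\<And>I J. A $ J $ I = (LINT p|\<mu>. f I p * g J p)"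
  shows "W \<bullet> (A *v V) = (LINT p|\<mu>. (\<Sum>I\<in>UNIV. V $ I * f I p) * (\<Sum>J\<in>UNIV. W $ J * g J p))"
proof -
  have "W \<bullet> (A *v V) = (\<Sum>J\<in>UNIV. \<Sum>I\<in>UNIV. (LINT p|\<mu>. (V $ I * W $ J) * (f I p * g J p)))"
    by (simp add: inner_vec_def matrix_vector_mult_def A sum_distrib_left mult_ac)
  also have "\<dots> = (LINT p|\<mu>. (\<Sum>J\<in>UNIV. \<Sum>I\<in>UNIV. (V $ I * W $ J) * (f I p * g J p)))"
    using int by (simp add: Bochner_Integration.integral_sum)
  also have "(\<lambda>p. \<Sum>J\<in>UNIV. \<Sum>I\<in>UNIV. (V $ I * W $ J) * (f I p * g J p)) =
      (\<lambda>p. (\<Sum>I\<in>UNIV. V $ I * f I p) * (\<Sum>J\<in>UNIV. W $ J * g J p))"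
    by (subst sum.swap) (simp add: sum_product mult_ac)
  finally show ?thesis .
qed

text \<open>
  The square of the difference is continuous and nonnegative with integral zero.
\<close>

lemma continuous_AE_eq_imp_eq:
  fixes f g :: "real \<Rightarrow> real"
  assumes "a < b" "continuous_on {a..b} f" "continuous_on {a..b} g"
    and eq: "AE s in lebesgue_on {a..b}. f s = g s" and s: "s \<in> {a..b}"
  shows "f s = g s"
proof -
  have "(LINT s|lebesgue_on {a..b}. (f s - g s)\<^sup>2) = (LINT s|lebesgue_on {a..b}. 0)"
    by (rule integral_lebesgue_on_cong_AE) (use eq in \<open>auto elim!: eventually_mono\<close>)
  then have "\<forall>s\<in>{a..b}. (f s - g s)\<^sup>2 = 0"
    using assms by (subst integralL_eq_0_iff[symmetric]) (auto intro!: continuous_intros)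
  then show ?thesis
    using s by simp
qed

section \<open>The matrices of the scheme as integral forms\<close>

locale periodic_fe_basis =
  fixes L :: real and n :: nat and x y :: "nat \<Rightarrow> real"
    and node :: "'m::finite \<Rightarrow> nat \<times> nat" and \<phi> :: "'m \<Rightarrow> real \<times> real \<Rightarrow> real"
  assumes L: "0 < L" and n: "2 \<le> n"
    and px: "is_partition L n x" and py: "is_partition L n y"
    and basis: "periodic_nodal_basis L n x y node \<phi>"
begin

abbreviation u :: "real ^ 'm \<Rightarrow> real \<times> real \<Rightarrow> real" where
  "u \<equiv> fe_function \<phi>"

definition Dx :: "(real \<times> real \<Rightarrow> real) \<Rightarrow> real \<times> real \<Rightarrow> real" where
  "Dx v p = (1, 0) \<bullet> pw_grad n x y v p"

definition Dy :: "(real \<times> real \<Rightarrow> real) \<Rightarrow> real \<times> real \<Rightarrow> real" where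
  "Dy v p = (0, 1) \<bullet> pw_grad n x y v p"

abbreviation sq_integral :: "(real \<times> real \<Rightarrow> real) \<Rightarrow> real" where
  "sq_integral f \<equiv> (LINT p|lebesgue_on (square L). f p)"

lemma basis_in_fe_space: "\<phi> I \<in> fe_space L n x y" "\<phi> I \<in> H1_periodic L"
  using basis by (auto simp: periodic_nodal_basis_def fe_space_periodic_def)

lemma continuous_on_fe_space: "v \<in> fe_space L n x y \<Longrightarrow> continuous_on ({0..L} \<times> {0..L}) v"
  by (simp add: fe_space_def)

lemma fe_function_in_fe_space: "u V \<in> fe_space L n x y"
  unfolding fe_space_def mem_Collect_eq
proof (intro conjI ballI)
  show "continuous_on ({0..L} \<times> {0..L}) (u V)"
    unfolding fe_function_def[abs_def] by (intro continuous_intros continuous_on_fe_space basis_in_fe_space(1))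
  fix T assume "T \<in> triangulation n x y"
  then have affine: "\<exists>a b c. \<forall>(s, t)\<in>T. \<phi> I (s, t) = a * s + b * t + c" for I
    using basis_in_fe_space(1)[of I] unfolding fe_space_def by blast
  have "\<exists>v. \<forall>(s, t)\<in>T. \<phi> I (s, t) = fst v * s + fst (snd v) * t + snd (snd v)" for I
  proof -
    obtain a b c where "\<forall>(s, t)\<in>T. \<phi> I (s, t) = a * s + b * t + c"
      using affine by blast
    then show ?thesis
      by (intro exI[of _ "(a, b, c)"]) simp
  qed
  then have "\<exists>v. \<forall>I. \<forall>(s, t)\<in>T. \<phi> I (s, t) = fst (v I) * s + fst (snd (v I)) * t + snd (snd (v I))"
    by (intro choice allI)
  then obtain v where v: "\<And>I. \<forall>(s, t)\<in>T. \<phi> I (s, t) = fst (v I) * s + fst (snd (v I)) * t + snd (snd (v I))"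
    by blast
  define a b c where "a I = fst (v I)" and "b I = fst (snd (v I))" and "c I = snd (snd (v I))" for I
  have abc: "\<forall>(s, t)\<in>T. \<phi> I (s, t) = a I * s + b I * t + c I" for I
    using v[of I] by (simp add: a_def b_def c_def)
  have "u V (s, t) = (\<Sum>I\<in>UNIV. V $ I * a I) * s + (\<Sum>I\<in>UNIV. V $ I * b I) * t + (\<Sum>I\<in>UNIV. V $ I * c I)"
    if "(s, t) \<in> T" for s t
  proof -
    have "\<phi> I (s, t) = a I * s + b I * t + c I" for I
      using abc[of I] that by auto
    then show ?thesis
      by (simp add: fe_function_def algebra_simps sum.distrib sum_distrib_left)
  qed
  then show "\<exists>a b c. \<forall>(s, t)\<in>T. u V (s, t) = a * s + b * t + c"
    by (intro exI) auto
qed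

lemma pw_grad_fe_function: "pw_grad n x y (u V) p = (\<Sum>I\<in>UNIV. V $ I *\<^sub>R pw_grad n x y (\<phi> I) p)"
proof -
  have slope: "slope x y (u V) \<tau> = (\<Sum>I\<in>UNIV. V $ I *\<^sub>R slope x y (\<phi> I) \<tau>)" for \<tau>
  proof -
    obtain i j l where \<tau>: "\<tau> = (i, j, l)" by (cases \<tau>)
    show ?thesis
      unfolding \<tau>
      by (rule prod_eqI; cases l)
        (simp_all add: slope.simps fe_function_def fst_sum snd_sum sum_subtractf sum_divide_distrib
          right_diff_distrib diff_divide_distrib)
  qed
  show ?thesis
    unfolding pw_grad_def slope scaleR_sum_right
    by (subst sum.swap) (simp add: mult.commute)
qed

lemma Dx_fe_function: "Dx (u V) p = (\<Sum>I\<in>UNIV. V $ I * Dx (\<phi> I) p)"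
  and Dy_fe_function: "Dy (u V) p = (\<Sum>I\<in>UNIV. V $ I * Dy (\<phi> I) p)"
  by (simp_all add: Dx_def Dy_def pw_grad_fe_function inner_sum_right)

lemma basis_plane: "(1, 0) \<in> (Basis :: (real \<times> real) set)" "(0, 1) \<in> (Basis :: (real \<times> real) set)"
  by (auto simp: Basis_prod_def)

lemma basis_weak_deriv_exists: "e \<in> Basis \<Longrightarrow> \<exists>g. is_weak_deriv (square L) e (\<phi> I) g"
  using basis_in_fe_space(2)[of I] by (auto simp: H1_periodic_def H1_space_def)

lemma fe_function_weak_deriv_exists:
  assumes e: "e \<in> Basis"
  shows "\<exists>g. is_weak_deriv (square L) e (u V) g"
proof -
  obtain g where "\<And>I. is_weak_deriv (square L) e (\<phi> I) (g I)"
    using basis_weak_deriv_exists[OF e] by metis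
  then have "is_weak_deriv (square L) e (\<lambda>p. \<Sum>I\<in>UNIV. V $ I * \<phi> I p) (\<lambda>p. \<Sum>I\<in>UNIV. V $ I * g I p)"
    by (intro is_weak_deriv_sum square_sets_lebesgue e) auto
  then show ?thesis
    unfolding fe_function_def[abs_def] by blast
qed

lemma d_basis_AE:
  "AE p in lebesgue_on (square L). d_x (square L) (\<phi> I) p = Dx (\<phi> I) p"
  "AE p in lebesgue_on (square L). d_y (square L) (\<phi> I) p = Dy (\<phi> I) p"
proof -
  have "AE p in lebesgue_on (square L). weak_deriv (square L) e (\<phi> I) p = e \<bullet> pw_grad n x y (\<phi> I) p"
    if "e \<in> Basis" for e
    using basis_weak_deriv_exists[OF that] weak_deriv_fe_space_AE[OF px py n basis_in_fe_space(1) that] by metis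
  from this[OF basis_plane(1)] this[OF basis_plane(2)]
  show "AE p in lebesgue_on (square L). d_x (square L) (\<phi> I) p = Dx (\<phi> I) p"
    "AE p in lebesgue_on (square L). d_y (square L) (\<phi> I) p = Dy (\<phi> I) p"
    unfolding d_x_def d_y_def Dx_def Dy_def .
qed

lemma d_fe_function_AE:
  "AE p in lebesgue_on (square L). d_x (square L) (u V) p = Dx (u V) p"
  "AE p in lebesgue_on (square L). d_y (square L) (u V) p = Dy (u V) p"
proof -
  have "AE p in lebesgue_on (square L). weak_deriv (square L) e (u V) p = e \<bullet> pw_grad n x y (u V) p"
    if "e \<in> Basis" for e
    using fe_function_weak_deriv_exists[OF that] weak_deriv_fe_space_AE[OF px py n fe_function_in_fe_space that]
    by metis
  from this[OF basis_plane(1)] this[OF basis_plane(2)]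
  show "AE p in lebesgue_on (square L). d_x (square L) (u V) p = Dx (u V) p"
    "AE p in lebesgue_on (square L). d_y (square L) (u V) p = Dy (u V) p"
    unfolding d_x_def d_y_def Dx_def Dy_def .
qed

lemma bounded_measurable_fe:
  assumes "v \<in> fe_space L n x y"
  shows "bounded_measurable (square L) v"
  using continuous_on_fe_space[OF assms] _ _ square_sets_lebesgue
  by (rule bounded_measurable_continuous) (auto simp: square_def intro: compact_Times)

lemma bounded_measurable_grad: "bounded_measurable (square L) (Dx v)" "bounded_measurable (square L) (Dy v)"
  unfolding Dx_def[abs_def] Dy_def[abs_def] pw_grad_def inner_sum_right inner_scaleR_right
  by (intro bounded_measurable_sum bounded_measurable_mult bounded_measurable_indicator
      bounded_measurable_const finite_triangle_indices open_open_triangle)+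

lemmas bounded_measurable_intros =
  bounded_measurable_fe[OF basis_in_fe_space(1)] bounded_measurable_fe[OF fe_function_in_fe_space] bounded_measurable_grad
  bounded_measurable_add bounded_measurable_mult bounded_measurable_const

lemma integrable_if_bounded_measurable:
  "bounded_measurable (square L) f \<Longrightarrow> integrable (lebesgue_on (square L)) f"
  using square_lmeasurable by (rule bounded_measurable_integrable)

lemma sq_integral_cong_AE:
  assumes "bounded_measurable (square L) g" "AE p in lebesgue_on (square L). f p = g p"
  shows "sq_integral f = sq_integral g"
  using square_sets_lebesgue _ assms(2)
  by (rule integral_lebesgue_on_cong_AE) (use assms(1) in \<open>simp add: bounded_measurable_def\<close>)

lemma M_form: "W \<bullet> (M_mat (square L) \<phi> *v V) = sq_integral (\<lambda>p. u V p * u W p)"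
  unfolding fe_function_def
  by (rule quadratic_form_eq_integral)
    (auto simp: M_mat_def L2_inner_def intro!: integrable_if_bounded_measurable bounded_measurable_intros)

lemma R_form: "W \<bullet> (R_mat (square L) \<phi> k *v V) = k * sq_integral (\<lambda>p. Dy (u V) p * u W p)"
proof -
  have "W \<bullet> (R_mat (square L) \<phi> k *v V) =
      sq_integral (\<lambda>p. (\<Sum>I\<in>UNIV. V $ I * (k * Dy (\<phi> I) p)) * (\<Sum>J\<in>UNIV. W $ J * \<phi> J p))"
  proof (rule quadratic_form_eq_integral)
    show "integrable (lebesgue_on (square L)) (\<lambda>p. k * Dy (\<phi> I) p * \<phi> J p)" for I J
      by (intro integrable_if_bounded_measurable bounded_measurable_intros)
    have "sq_integral (\<lambda>p. k * d_y (square L) (\<phi> I) p * \<phi> J p) = sq_integral (\<lambda>p. k * Dy (\<phi> I) p * \<phi> J p)" for I J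
    proof (rule sq_integral_cong_AE)
      show "AE p in lebesgue_on (square L). k * d_y (square L) (\<phi> I) p * \<phi> J p = k * Dy (\<phi> I) p * \<phi> J p"
        using d_basis_AE(2)[of I] by eventually_elim simp
    qed (intro bounded_measurable_intros)
    then show "R_mat (square L) \<phi> k $ J $ I = sq_integral (\<lambda>p. k * Dy (\<phi> I) p * \<phi> J p)" for I J
      by (simp add: R_mat_def L2_inner_def)
  qed
  also have "\<dots> = sq_integral (\<lambda>p. k * (Dy (u V) p * u W p))"
    by (simp add: Dy_fe_function fe_function_def sum_distrib_left mult_ac)
  finally show ?thesis by simp
qed

lemma K_form:
  "W \<bullet> (K_mat (square L) \<phi> *v V) =
     sq_integral (\<lambda>p. u V p * u W p) + sq_integral (\<lambda>p. Dx (u V) p * Dx (u W) p) + sq_integral (\<lambda>p. Dy (u V) p * Dy (u W) p)"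
proof -
  let ?X = "(\<chi> J I. sq_integral (\<lambda>p. Dx (\<phi> I) p * Dx (\<phi> J) p)) :: real ^ 'm ^ 'm"
  let ?Y = "(\<chi> J I. sq_integral (\<lambda>p. Dy (\<phi> I) p * Dy (\<phi> J) p)) :: real ^ 'm ^ 'm"
  have int: "integrable (lebesgue_on (square L)) (\<lambda>p. Dx (\<phi> I) p * Dx (\<phi> J) p)"
    "integrable (lebesgue_on (square L)) (\<lambda>p. Dy (\<phi> I) p * Dy (\<phi> J) p)" for I J
    by (intro integrable_if_bounded_measurable bounded_measurable_intros)+
  have "L2_inner (square L) (grad (square L) (\<phi> I)) (grad (square L) (\<phi> J)) =
      sq_integral (\<lambda>p. Dx (\<phi> I) p * Dx (\<phi> J) p + Dy (\<phi> I) p * Dy (\<phi> J) p)" for I J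
    unfolding L2_inner_def
  proof (rule sq_integral_cong_AE)
    show "AE p in lebesgue_on (square L). grad (square L) (\<phi> I) p \<bullet> grad (square L) (\<phi> J) p =
        Dx (\<phi> I) p * Dx (\<phi> J) p + Dy (\<phi> I) p * Dy (\<phi> J) p"
      using d_basis_AE[of I] d_basis_AE[of J] by eventually_elim (simp add: grad_def)
  qed (intro bounded_measurable_intros)
  then have "K_mat (square L) \<phi> = M_mat (square L) \<phi> + ?X + ?Y"
    using int by (simp add: vec_eq_iff K_mat_def M_mat_def H1_inner_def)
  then have "W \<bullet> (K_mat (square L) \<phi> *v V) = W \<bullet> (M_mat (square L) \<phi> *v V) + W \<bullet> (?X *v V) + W \<bullet> (?Y *v V)"
    by (simp add: matrix_vector_mult_add_rdistrib inner_add_right)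
  also have "W \<bullet> (?X *v V) = sq_integral (\<lambda>p. Dx (u V) p * Dx (u W) p)"
    unfolding Dx_fe_function by (rule quadratic_form_eq_integral) (simp_all add: int)
  also have "W \<bullet> (?Y *v V) = sq_integral (\<lambda>p. Dy (u V) p * Dy (u W) p)"
    unfolding Dy_fe_function by (rule quadratic_form_eq_integral) (simp_all add: int)
  finally show ?thesis
    by (simp add: M_form)
qed

lemma S_entry:
  "S_mat (square L) \<phi> U $ J $ I =
     sq_integral (\<lambda>p. (Dx (u U) p * Dy (\<phi> I) p - Dy (u U) p * Dx (\<phi> I) p) * \<phi> J p)"
proof -
  have "sq_integral (\<lambda>p. (flow_field (square L) (u U) p \<bullet> grad (square L) (\<phi> I) p) \<bullet> \<phi> J p) =
      sq_integral (\<lambda>p. (Dx (u U) p * Dy (\<phi> I) p + (- 1) * (Dy (u U) p * Dx (\<phi> I) p)) * \<phi> J p)"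
  proof (rule sq_integral_cong_AE)
    show "AE p in lebesgue_on (square L). (flow_field (square L) (u U) p \<bullet> grad (square L) (\<phi> I) p) \<bullet> \<phi> J p =
        (Dx (u U) p * Dy (\<phi> I) p + (- 1) * (Dy (u U) p * Dx (\<phi> I) p)) * \<phi> J p"
      using d_basis_AE[of I] d_fe_function_AE[of U]
      by eventually_elim (simp add: grad_def flow_field_def)
  qed (intro bounded_measurable_intros)
  then show ?thesis
    by (simp add: S_mat_def L2_inner_def)
qed

lemma S_form:
  "W \<bullet> (S_mat (square L) \<phi> U *v V) = sq_integral (\<lambda>p. (Dx (u U) p * Dy (u V) p - Dy (u U) p * Dx (u V) p) * u W p)"
proof -
  have "W \<bullet> (S_mat (square L) \<phi> U *v V) =
      sq_integral (\<lambda>p. (\<Sum>I\<in>UNIV. V $ I * (Dx (u U) p * Dy (\<phi> I) p - Dy (u U) p * Dx (\<phi> I) p)) *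
        (\<Sum>J\<in>UNIV. W $ J * \<phi> J p))"
  proof (rule quadratic_form_eq_integral)
    have "integrable (lebesgue_on (square L))
        (\<lambda>p. (Dx (u U) p * Dy (\<phi> I) p + (- 1) * (Dy (u U) p * Dx (\<phi> I) p)) * \<phi> J p)" for I J
      by (intro integrable_if_bounded_measurable bounded_measurable_intros)
    then show "integrable (lebesgue_on (square L))
        (\<lambda>p. (Dx (u U) p * Dy (\<phi> I) p - Dy (u U) p * Dx (\<phi> I) p) * \<phi> J p)" for I J
      by simp
  qed (rule S_entry)
  then show ?thesis
    by (simp add: Dx_fe_function[of V] Dy_fe_function[of V] fe_function_def[of \<phi> W] sum_distrib_left
        right_diff_distrib sum_subtractf mult_ac)
qed

text \<open>
  The matrix depends linearly on the coefficients of the transporting function.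
\<close>

lemma continuous_S_mat: "continuous_on UNIV (S_mat (square L) \<phi>)"
proof -
  have "S_mat (square L) \<phi> = (\<lambda>U. \<chi> J I. \<Sum>H\<in>UNIV. U $ H *
      sq_integral (\<lambda>p. (Dx (\<phi> H) p * Dy (\<phi> I) p + (- 1) * (Dy (\<phi> H) p * Dx (\<phi> I) p)) * \<phi> J p))"
  proof (intro ext, unfold vec_eq_iff, intro allI)
    fix U :: "real ^ 'm" and J I
    have "integrable (lebesgue_on (square L))
        (\<lambda>p. (Dx (\<phi> H) p * Dy (\<phi> I) p + (- 1) * (Dy (\<phi> H) p * Dx (\<phi> I) p)) * \<phi> J p)" for H
      by (intro integrable_if_bounded_measurable bounded_measurable_intros)
    then have "(\<Sum>H\<in>UNIV. U $ H *
        sq_integral (\<lambda>p. (Dx (\<phi> H) p * Dy (\<phi> I) p + (- 1) * (Dy (\<phi> H) p * Dx (\<phi> I) p)) * \<phi> J p)) =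
      sq_integral (\<lambda>p. \<Sum>H\<in>UNIV. U $ H * ((Dx (\<phi> H) p * Dy (\<phi> I) p + (- 1) * (Dy (\<phi> H) p * Dx (\<phi> I) p)) * \<phi> J p))"
      by (subst Bochner_Integration.integral_sum) auto
    also have "\<dots> = S_mat (square L) \<phi> U $ J $ I"
      unfolding S_entry Dx_fe_function Dy_fe_function
      by (simp add: sum_distrib_right sum_distrib_left algebra_simps sum_subtractf)
    finally show "S_mat (square L) \<phi> U $ J $ I = (\<chi> J I. \<Sum>H\<in>UNIV. U $ H *
      sq_integral (\<lambda>p. (Dx (\<phi> H) p * Dy (\<phi> I) p + (- 1) * (Dy (\<phi> H) p * Dx (\<phi> I) p)) * \<phi> J p)) $ J $ I"
      by simp
  qed
  then show ?thesis
    by (auto intro!: continuous_intros)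
qed

section \<open>Skew symmetry of the transport term\<close>

text \<open>
  Membership in the periodic space gives the boundary conditions almost everywhere; continuity gives
  them at the grid points.
\<close>

lemma fe_function_periodic:
  assumes s: "s \<in> {0..L}"
  shows "u V (s, 0) = u V (s, L)" "u V (0, s) = u V (L, s)"
proof -
  have "\<phi> I (s, 0) = \<phi> I (s, L)" "\<phi> I (0, s) = \<phi> I (L, s)" for I
  proof -
    have cont: "continuous_on {0..L} (\<lambda>s. \<phi> I (f s))" if "continuous_on {0..L} f" "f ` {0..L} \<subseteq> {0..L} \<times> {0..L}" for f
      using continuous_on_fe_space[OF basis_in_fe_space(1)] that by (rule continuous_on_compose2)
    show "\<phi> I (s, 0) = \<phi> I (s, L)"
      by (rule continuous_AE_eq_imp_eq[OF L _ _ _ s])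
        (use basis_in_fe_space(2)[of I] L in \<open>auto simp: H1_periodic_def intro!: cont continuous_intros\<close>)
    show "\<phi> I (0, s) = \<phi> I (L, s)"
      by (rule continuous_AE_eq_imp_eq[OF L _ _ _ s])
        (use basis_in_fe_space(2)[of I] L in \<open>auto simp: H1_periodic_def intro!: cont continuous_intros\<close>)
  qed
  then show "u V (s, 0) = u V (s, L)" "u V (0, s) = u V (L, s)"
    by (simp_all add: fe_function_def)
qed

lemma grid_periodic:
  assumes "i \<in> {1..n}"
  shows "u V (x i, y n) = u V (x i, y 1)" "u V (x n, y i) = u V (x 1, y i)"
  using fe_function_periodic[of "x i" V] fe_function_periodic[of "y i" V]
    partition_bounds[OF px assms] partition_bounds[OF py assms] px py
  by (auto simp: is_partition_def)

text \<open>
  On one triangle the Jacobian determinant is constant, and the cell dimensions in the slopes cancel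
  against those in the area.
\<close>

lemma integral_triangle_jacobian:
  fixes U W :: "real ^ 'm"
  assumes ij: "i \<in> {1..<n}" "j \<in> {1..<n}"
    and c: "\<And>p. p \<in> closed_triangle x y (i, j, l) \<Longrightarrow> u W p = p \<bullet> slope x y (u W) (i, j, l) + c"
  defines "E \<equiv> \<lambda>i j i' j'. edge_term (u U (x i, y j)) (u W (x i, y j)) (u U (x i', y j')) (u W (x i', y j'))"
    and "a \<equiv> slope x y (u U) (i, j, l)" and "b \<equiv> slope x y (u W) (i, j, l)"
  shows "(LINT p|lborel. indicator (open_triangle x y (i, j, l)) p * ((fst a * snd b - snd a * fst b) * (p \<bullet> b + c))) =
    (if l then E i j (i+1) j + E (i+1) j (i+1) (j+1) + E (i+1) (j+1) i j
     else E i j (i+1) (j+1) + E (i+1) (j+1) i (j+1) + E i (j+1) i j) / 6"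
proof -
  let ?T = "open_triangle x y (i, j, l)" and ?J = "fst a * snd b - snd a * fst b"
  define hx hy where "hx = x (i+1) - x i" and "hy = y (j+1) - y j"
  have h: "0 < hx" "0 < hy"
    using partition_less_Suc[OF px ij(1)] partition_less_Suc[OF py ij(2)] by (auto simp: hx_def hy_def)
  define w where "w i j = u W (x i, y j)" for i j
  define v where "v i j = u U (x i, y j)" for i j
  have vertices: "(x i, y j) \<in> closed_triangle x y (i, j, l)" "(x (i+1), y (j+1)) \<in> closed_triangle x y (i, j, l)"
    "l \<Longrightarrow> (x (i+1), y j) \<in> closed_triangle x y (i, j, l)"
    "\<not> l \<Longrightarrow> (x i, y (j+1)) \<in> closed_triangle x y (i, j, l)"
    unfolding closed_triangle.simps by (auto intro!: hull_inc)
  have affine: "u W p = fst b * fst p + snd b * snd p + c" if "p \<in> closed_triangle x y (i, j, l)" for p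
    using c[OF that] unfolding b_def[symmetric] by (simp add: inner_prod_def mult.commute)
  have w: "fst b * x i + snd b * y j + c = w i j" "fst b * x (i+1) + snd b * y (j+1) + c = w (i+1) (j+1)"
    "l \<Longrightarrow> fst b * x (i+1) + snd b * y j + c = w (i+1) j"
    "\<not> l \<Longrightarrow> fst b * x i + snd b * y (j+1) + c = w i (j+1)"
    using affine[OF vertices(1)] affine[OF vertices(2)] affine[OF vertices(3)] affine[OF vertices(4)]
    by (simp_all add: w_def)
  have "(LINT p|lborel. indicator ?T p * (?J * (p \<bullet> b + c))) =
      ?J * (LINT p|lborel. indicator ?T p * (fst b * fst p + snd b * snd p + c))"
    by (subst integral_mult_right_zero[symmetric]) (simp add: inner_prod_def mult_ac)
  also have "(LINT p|lborel. indicator ?T p * (fst b * fst p + snd b * snd p + c)) =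
      hx * hy / 6 * (if l then w i j + w (i+1) j + w (i+1) (j+1) else w i j + w (i+1) (j+1) + w i (j+1))"
    unfolding hx_def hy_def
    using integral_affine_open_triangle[OF partition_less_Suc[OF px ij(1)] partition_less_Suc[OF py ij(2)],
        of l "fst b" "snd b" c] w
    by (cases l) simp_all
  finally have eq: "(LINT p|lborel. indicator ?T p * (?J * (p \<bullet> b + c))) =
    (?J * (hx * hy)) * (if l then w i j + w (i+1) j + w (i+1) (j+1) else w i j + w (i+1) (j+1) + w i (j+1)) / 6"
    by (simp add: mult_ac)
  show ?thesis
  proof (cases l)
    case True
    have "a = ((v (i+1) j - v i j) / hx, (v (i+1) (j+1) - v (i+1) j) / hy)"
      "b = ((w (i+1) j - w i j) / hx, (w (i+1) (j+1) - w (i+1) j) / hy)"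
      using True by (simp_all add: a_def b_def v_def w_def hx_def hy_def slope.simps)
    then have "?J * (hx * hy) = (v (i+1) j - v i j) * (w (i+1) (j+1) - w (i+1) j) -
        (v (i+1) (j+1) - v (i+1) j) * (w (i+1) j - w i j)"
      using h by (simp add: field_simps)
    then show ?thesis
      unfolding eq using True
        triangle_edge_terms[of "v (i+1) j" "v i j" "w (i+1) (j+1)" "w (i+1) j" "v (i+1) (j+1)" "w i j"]
      by (simp add: E_def v_def w_def)
  next
    case False
    have "a = ((v (i+1) (j+1) - v i (j+1)) / hx, (v i (j+1) - v i j) / hy)"
      "b = ((w (i+1) (j+1) - w i (j+1)) / hx, (w i (j+1) - w i j) / hy)"
      using False by (simp_all add: a_def b_def v_def w_def hx_def hy_def slope.simps)
    then have "?J * (hx * hy) = (v (i+1) (j+1) - v i (j+1)) * (w i (j+1) - w i j) -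
        (v i (j+1) - v i j) * (w (i+1) (j+1) - w i (j+1))"
      using h by (simp add: field_simps)
    also have "\<dots> = (v (i+1) (j+1) - v i j) * (w i (j+1) - w (i+1) (j+1)) -
        (v i (j+1) - v (i+1) (j+1)) * (w (i+1) (j+1) - w i j)"
      by (simp add: algebra_simps)
    finally show ?thesis
      unfolding eq using False
        triangle_edge_terms[of "v (i+1) (j+1)" "v i j" "w i (j+1)" "w (i+1) (j+1)" "v i (j+1)" "w i j"]
      by (simp add: E_def v_def w_def)
  qed
qed

text \<open>
  Discrete counterpart of \<open>\<integral> (V(u) \<cdot> \<nabla>w) w = 0\<close> for the divergence-free field \<open>V(u)\<close>. It holds
  exactly, because the finite element functions are continuous across edges and periodic.
\<close>

lemma S_skew: "W \<bullet> (S_mat (square L) \<phi> U *v W) = 0"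
proof -
  let ?J = "\<lambda>p. Dx (u U) p * Dy (u W) p - Dy (u U) p * Dx (u W) p"
  define a where "a = slope x y (u U)"
  define b where "b = slope x y (u W)"
  have "\<forall>\<tau>\<in>triangle_indices n. \<exists>c. \<forall>p\<in>closed_triangle x y \<tau>. u W p = p \<bullet> b \<tau> + c"
    using fe_space_affine[OF px py fe_function_in_fe_space] unfolding b_def by meson
  from bchoice[OF this] obtain c where
    c: "\<And>\<tau> p. \<tau> \<in> triangle_indices n \<Longrightarrow> p \<in> closed_triangle x y \<tau> \<Longrightarrow> u W p = p \<bullet> b \<tau> + c \<tau>"
    by blast
  define g where "g \<tau> p = (fst (a \<tau>) * snd (b \<tau>) - snd (a \<tau>) * fst (b \<tau>)) * (p \<bullet> b \<tau> + c \<tau>)" for \<tau> p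
  define E where "E i j i' j' = edge_term (u U (x i, y j)) (u W (x i, y j)) (u U (x i', y j')) (u W (x i', y j'))"
    for i j i' j'
  have g: "(LINT p|lborel. indicator (open_triangle x y (i, j, l)) p * g (i, j, l) p) =
      (if l then E i j (i+1) j + E (i+1) j (i+1) (j+1) + E (i+1) (j+1) i j
       else E i j (i+1) (j+1) + E (i+1) (j+1) i (j+1) + E i (j+1) i j) / 6"
    if "i \<in> {1..<n}" "j \<in> {1..<n}" for i j l
    unfolding g_def a_def b_def E_def
  proof (rule integral_triangle_jacobian[OF that])
    show "u W p = p \<bullet> slope x y (u W) (i, j, l) + c (i, j, l)" if "p \<in> closed_triangle x y (i, j, l)" for p
      using c[OF _ that] \<open>i \<in> {1..<n}\<close> \<open>j \<in> {1..<n}\<close> by (simp add: triangle_indices_def b_def)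
  qed
  have "W \<bullet> (S_mat (square L) \<phi> U *v W) = sq_integral (\<lambda>p. ?J p * u W p)"
    by (rule S_form)
  also have "\<dots> = (\<Sum>\<tau>\<in>triangle_indices n. LINT p|lborel. indicator (open_triangle x y \<tau>) p * g \<tau> p)"
  proof (rule integral_square_eq_sum_triangles[OF px py n])
    show "?J p * u W p = g \<tau> p" if "\<tau> \<in> triangle_indices n" "p \<in> open_triangle x y \<tau>" for \<tau> p
      using c[OF that(1) subsetD[OF open_triangle_subset_closed_triangle that(2)]]
      by (simp add: g_def Dx_def Dy_def pw_grad_eq_slope[OF px py that] a_def b_def inner_prod_def)
    show "integrable lborel (\<lambda>p. indicator (open_triangle x y \<tau>) p * g \<tau> p)" for \<tau>
    proof -
      obtain i j l where "\<tau> = (i, j, l)" by (cases \<tau>)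
      then show ?thesis
        unfolding g_def
        by (simp only:) (intro continuous_intros integrable_indicator_mult_continuous
          [OF borel_open[OF open_open_triangle] open_triangle_subset_cbox])
    qed
    have "bounded_measurable (square L) (\<lambda>p. (Dx (u U) p * Dy (u W) p + (- 1) * (Dy (u U) p * Dx (u W) p)) * u W p)"
      by (intro bounded_measurable_intros)
    then show "(\<lambda>p. ?J p * u W p) \<in> borel_measurable (lebesgue_on (square L))"
      by (simp add: bounded_measurable_def)
  qed
  also have "\<dots> = (\<Sum>i\<in>{1..<n}. \<Sum>j\<in>{1..<n}. \<Sum>l\<in>UNIV.
      LINT p|lborel. indicator (open_triangle x y (i, j, l)) p * g (i, j, l) p)"
    by (simp add: triangle_indices_def sum.cartesian_product case_prod_unfold)
  also have "\<dots> = (\<Sum>i\<in>{1..<n}. \<Sum>j\<in>{1..<n}.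
      (E i j (i+1) j + E (i+1) j (i+1) (j+1) + E (i+1) (j+1) i j) +
      (E i j (i+1) (j+1) + E (i+1) (j+1) i (j+1) + E i (j+1) i j)) / 6"
    unfolding sum_divide_distrib by (intro sum.cong refl) (simp only: g UNIV_bool, simp add: add_divide_distrib)
  also have "(\<Sum>i\<in>{1..<n}. \<Sum>j\<in>{1..<n}.
      (E i j (i+1) j + E (i+1) j (i+1) (j+1) + E (i+1) (j+1) i j) +
      (E i j (i+1) (j+1) + E (i+1) (j+1) i (j+1) + E i (j+1) i j)) = 0"
    unfolding E_def using n grid_periodic by (intro sum_grid_edge_terms_eq_0) auto
  finally show ?thesis by simp
qed

section \<open>Existence of a fixed point\<close>

text \<open>
  A continuous function with vanishing \<open>L\<^sup>2\<close> norm is zero on the closed square, in particular at the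
  nodes, where its values are the coefficients.
\<close>

lemma M_pos:
  assumes "V \<noteq> 0"
  shows "0 < V \<bullet> (M_mat (square L) \<phi> *v V)"
proof (rule ccontr)
  have cont: "continuous_on (cbox (0, 0) (L, L)) (\<lambda>p. (u V p)\<^sup>2)"
    using continuous_on_fe_space[OF fe_function_in_fe_space, of V]
    by (auto simp: cbox_Pair_eq intro!: continuous_intros)
  have box: "square L = box (0, 0) (L, L)"
    by (auto simp: square_def box_def Basis_prod_def)
  have "integrable (lebesgue_on (square L)) (\<lambda>p. u V p * u V p)"
    by (intro integrable_if_bounded_measurable bounded_measurable_intros)
  then have "sq_integral (\<lambda>p. u V p * u V p) = integral (square L) (\<lambda>p. u V p * u V p)"
    using square_sets_lebesgue by (rule lebesgue_integral_eq_integral)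
  also have "\<dots> = integral (cbox (0, 0) (L, L)) (\<lambda>p. (u V p)\<^sup>2)"
    by (simp add: box integral_open_interval power2_eq_square)
  finally have form: "V \<bullet> (M_mat (square L) \<phi> *v V) = integral (cbox (0, 0) (L, L)) (\<lambda>p. (u V p)\<^sup>2)"
    by (simp add: M_form)
  moreover have "0 \<le> integral (cbox (0, 0) (L, L)) (\<lambda>p. (u V p)\<^sup>2)"
    using integrable_continuous[OF cont] by (rule integral_nonneg) simp
  moreover assume "\<not> 0 < V \<bullet> (M_mat (square L) \<phi> *v V)"
  ultimately have zero_int: "integral (cbox (0, 0) (L, L)) (\<lambda>p. (u V p)\<^sup>2) = 0" by linarith
  have "(L / 2, L / 2) \<in> square L"
    using L by (simp add: square_def)
  then have "box (0, 0) (L, L) \<noteq> {}"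
    unfolding box by blast
  then have "\<forall>p\<in>cbox (0, 0) (L, L). (u V p)\<^sup>2 = 0"
    using integral_cbox_eq_0_iff[OF cont] zero_int by (meson zero_le_power2)
  then have zero: "u V p = 0" if "p \<in> cbox (0, 0) (L, L)" for p
    using that by fastforce
  have "V $ J = 0" for J
  proof -
    obtain i j where ij: "node J = (i, j)" by (cases "node J")
    have "node J \<in> {1..<n} \<times> {1..<n}"
      using basis unfolding periodic_nodal_basis_def by (meson UNIV_I bij_betw_apply)
    then have "i \<in> {1..<n}" "j \<in> {1..<n}"
      using ij by auto
    then have "u V (x i, y j) = 0"
      using partition_bounds[OF px, of i] partition_bounds[OF py, of j] by (intro zero) (auto simp: cbox_Pair_eq)
    moreover have "\<phi> I (x i, y j) = (if I = J then 1 else 0)" for I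
    proof -
      have "\<phi> I (x (fst (node J)), y (snd (node J))) = (if I = J then 1 else 0)"
        using basis unfolding periodic_nodal_basis_def by blast
      then show ?thesis by (simp add: ij)
    qed
    ultimately show "V $ J = 0"
      by (simp add: fe_function_def if_distrib cong: if_cong)
  qed
  then show False
    using assms by (simp add: vec_eq_iff)
qed

lemma young_integral:
  assumes f: "bounded_measurable (square L) f" and g: "bounded_measurable (square L) g" 
  shows "2 * sq_integral (\<lambda>p. f p * g p) \<le> sq_integral (\<lambda>p. f p * f p) + sq_integral (\<lambda>p. g p * g p)"
proof -
  have int: "integrable (lebesgue_on (square L)) (\<lambda>p. f p * g p)"
    "integrable (lebesgue_on (square L)) (\<lambda>p. f p * f p)"
    "integrable (lebesgue_on (square L)) (\<lambda>p. g p * g p)"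
    by (intro integrable_if_bounded_measurable bounded_measurable_mult f g)+
  have "0 \<le> sq_integral (\<lambda>p. (f p - g p)\<^sup>2)"
    by (intro Bochner_Integration.integral_nonneg) simp
  also have "(\<lambda>p. (f p - g p)\<^sup>2) = (\<lambda>p. f p * f p + g p * g p - 2 * (f p * g p))"
    by (simp add: power2_eq_square algebra_simps)
  finally show ?thesis
    using int by simp
qed

lemma G_map_fixed_point_exists:
  assumes "0 < \<tau>" "k \<noteq> 0 \<longrightarrow> \<tau> \<le> 1 / (2 * \<bar>k\<bar>)"
  shows "\<exists>Y. Y = G_map (square L) \<phi> k \<tau> Z Y"
  unfolding G_map_def B_mat_def
proof (rule abstract_scheme_solvable[where k = k and q = "\<lambda>U. sq_integral (\<lambda>p. Dy (u U) p * Dy (u U) p)"])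
  show "0 < Y \<bullet> (M_mat (square L) \<phi> *v Y)" if "Y \<noteq> 0" for Y
    using that by (rule M_pos)
  show "U \<bullet> (M_mat (square L) \<phi> *v Y) \<le>
      U \<bullet> (M_mat (square L) \<phi> *v U) + Y \<bullet> (M_mat (square L) \<phi> *v Y) / 4" for U Y
  proof -
    \<comment> \<open>The weight \<open>1/2\<close> leaves the full \<open>\<parallel>u\<parallel>\<^sup>2\<close> on the right, where it cancels against \<open>U \<bullet> K U\<close>.\<close>
    have "2 * sq_integral (\<lambda>p. u U p * (1 / 2 * u Y p)) \<le>
        sq_integral (\<lambda>p. u U p * u U p) + sq_integral (\<lambda>p. (1 / 2 * u Y p) * (1 / 2 * u Y p))"
      by (intro young_integral bounded_measurable_intros)
    also have "sq_integral (\<lambda>p. (1 / 2 * u Y p) * (1 / 2 * u Y p)) = sq_integral (\<lambda>p. u Y p * u Y p) / 4"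
      by simp
    finally show ?thesis
      by (simp add: M_form mult.commute)
  qed
  show "0 \<le> sq_integral (\<lambda>p. Dy (u U) p * Dy (u U) p)" for U
    by (intro Bochner_Integration.integral_nonneg) simp
  show "U \<bullet> (M_mat (square L) \<phi> *v U) + sq_integral (\<lambda>p. Dy (u U) p * Dy (u U) p) \<le> U \<bullet> (K_mat (square L) \<phi> *v U)" for U
    by (simp add: M_form K_form Bochner_Integration.integral_nonneg)
  show "\<bar>Y \<bullet> (R_mat (square L) \<phi> k *v U)\<bar> \<le>
      \<bar>k\<bar> / 2 * (sq_integral (\<lambda>p. Dy (u U) p * Dy (u U) p) + Y \<bullet> (M_mat (square L) \<phi> *v Y))" for U Y
  proof -
    have "2 * \<bar>sq_integral (\<lambda>p. Dy (u U) p * u Y p)\<bar> \<le> sq_integral (\<lambda>p. Dy (u U) p * Dy (u U) p) + sq_integral (\<lambda>p. u Y p * u Y p)"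
    proof -
      have "2 * sq_integral (\<lambda>p. Dy (u U) p * u Y p) \<le> sq_integral (\<lambda>p. Dy (u U) p * Dy (u U) p) + sq_integral (\<lambda>p. u Y p * u Y p)"
        by (intro young_integral bounded_measurable_intros)
      moreover have "2 * sq_integral (\<lambda>p. Dy (u U) p * ((- 1) * u Y p)) \<le>
          sq_integral (\<lambda>p. Dy (u U) p * Dy (u U) p) + sq_integral (\<lambda>p. ((- 1) * u Y p) * ((- 1) * u Y p))"
        by (intro young_integral bounded_measurable_intros)
      ultimately show ?thesis
        by (simp add: abs_le_iff)
    qed
    from mult_left_mono[OF this, of "\<bar>k\<bar> / 2"] show ?thesis
      by (simp add: R_form M_form abs_mult)
  qed
qed (use assms S_skew continuous_S_mat in auto)

end

theorem theorem3p4: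
  fixes L k \<tau> :: real and n :: nat and x y :: "nat \<Rightarrow> real"
    and node :: "'m::finite \<Rightarrow> nat \<times> nat"
    and \<phi> :: "'m \<Rightarrow> real \<times> real \<Rightarrow> real"
    and Z :: "real ^ 'm"
  assumes "L > 0" and "n \<ge> 2"
    and "is_partition L n x" and "is_partition L n y"
    and "periodic_nodal_basis L n x y node \<phi>"
    and "0 < \<tau>" and "k \<noteq> 0 \<longrightarrow> \<tau> \<le> 1 / (2 * \<bar>k\<bar>)"
  shows "\<exists>Y :: real ^ 'm. Y = G_map (square L) \<phi> k \<tau> Z Y"
proof -
  interpret periodic_fe_basis L n x y node \<phi>
    using assms by unfold_locales auto
  show ?thesis
    using assms(6,7) by (rule G_map_fixed_point_exists)
qed

end
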